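(* Let $n\ge3$ and $\beta\in B_n$. (1) If $\inf(\beta)<0<\sup(\beta)$, then $\mathrm{nb}(\beta)\le (n-2)\,|\inf(\beta)|$. (2) If $\inf(\beta)<\sup(\beta)\le 0$, then $\mathrm{nb}(\beta)=-\mathrm{writhe}(\beta)\le (n-2)\,|\inf(\beta)|+|\sup(\beta)|$. Moreover, when $n=3$ the inequalities in both (1) and (2) are equalities.
   Context: $B_n$ is the braid group on $n$ strands with Artin generators $\sigma_1,\dots,\sigma_{n-1}$. For $1\le i<j\le n$ the band generator is $a_{ij}=(\sigma_{j-1}\sigma_{j-2}\cdots\sigma_{i+1})\,\sigma_i\,(\sigma_{j-1}\sigma_{j-2}\cdots\sigma_{i+1})^{-1}$. A braid word means a word in the $a_{ij}^{\pm1}$; the letters $a_{ij}^{-1}$ are negative bands. For a braid word $W$, $\mathrm{nb}(W)$ is the number of negative bands appearing in $W$; for $\beta\in B_n$ the negative band number $\mathrm{nb}(\beta)$ is the minimum of $\mathrm{nb}(W)$ over all braid words $W$ representing $\beta$. $\mathrm{writhe}(\beta)$ is the exponent sum of $\beta$ (number of positive bands minus number of negative bands in any word representing $\beta$). $SQP(n)\subset B_n$ is the monoid of braids represented by (possibly empty) words in the $a_{ij}$ with only positive exponents. For $V,W\in B_n$ write $V\le W$ if $W=PVQ$ for some $P,Q\in SQP(n)$. Let $\delta=\sigma_{n-1}\cdots\sigma_2\sigma_1$, $\inf(\beta)=\max\{r\in\mathbb Z:\delta^r\le\beta\}$, $\sup(\beta)=\min\{s\in\mathbb Z:\beta\le\delta^s\}$.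 *)

theory Defs
  imports "HOL-Algebra.Group"
begin

section \<open>The braid group by Artin's presentation\<close>

text \<open>A letter \<open>(i, True)\<close> stands for \<open>\<sigma>\<^sub>i\<close>, and \<open>(i, False)\<close> for its inverse.\<close>

type_synonym artin_word = "(nat \<times> bool) list"

definition artin_words :: "nat \<Rightarrow> artin_word set" where
  "artin_words n = lists ({1..<n} \<times> UNIV)"

text \<open>The words occurring in a derivation of \<open>artin_eq n\<close> only use the generators
  of the braid group on \<open>n\<close> strands.\<close>

inductive artin_eq :: "nat \<Rightarrow> artin_word \<Rightarrow> artin_word \<Rightarrow> bool" for n where
  artin_refl: "w \<in> artin_words n \<Longrightarrow> artin_eq n w w"
| artin_sym: "artin_eq n u v \<Longrightarrow> artin_eq n v u"
| artin_trans: "artin_eq n u v \<Longrightarrow> artin_eq n v w \<Longrightarrow> artin_eq n u w"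
| artin_append: "artin_eq n u u' \<Longrightarrow> artin_eq n v v' \<Longrightarrow> artin_eq n (u @ v) (u' @ v')"
| artin_cancel: "1 \<le> i \<Longrightarrow> i < n \<Longrightarrow> artin_eq n [(i, s), (i, \<not> s)] []"
| artin_commute: "1 \<le> i \<Longrightarrow> i + 2 \<le> j \<Longrightarrow> j < n \<Longrightarrow>
    artin_eq n [(i, True), (j, True)] [(j, True), (i, True)]"
| artin_braid: "1 \<le> i \<Longrightarrow> i + 1 < n \<Longrightarrow>
    artin_eq n [(i, True), (i + 1, True), (i, True)] [(i + 1, True), (i, True), (i + 1, True)]"

definition artin_rel :: "nat \<Rightarrow> (artin_word \<times> artin_word) set" where
  "artin_rel n = {(u, v). artin_eq n u v}"

definition braid_group :: "nat \<Rightarrow> artin_word set monoid" where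
  "braid_group n =
    \<lparr>carrier = artin_words n // artin_rel n,
     mult = (\<lambda>A B. \<Union>u\<in>A. \<Union>v\<in>B. artin_rel n `` {u @ v}),
     one = artin_rel n `` {[]}\<rparr>"

definition artin_gen :: "nat \<Rightarrow> nat \<Rightarrow> artin_word set" where
  "artin_gen n i = artin_rel n `` {[(i, True)]}"

definition braid_prod :: "nat \<Rightarrow> artin_word set list \<Rightarrow> artin_word set" where
  "braid_prod n xs = foldr (\<otimes>\<^bsub>braid_group n\<^esub>) xs \<one>\<^bsub>braid_group n\<^esub>"

section \<open>Band generators and braid words\<close>

text \<open>The product \<open>\<sigma>\<^sub>k\<^sub>-\<^sub>1 \<cdots> \<sigma>\<^sub>i\<close>, with descending indices; it is empty for \<open>k \<le> i\<close>.\<close>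

definition descending_prod :: "nat \<Rightarrow> nat \<Rightarrow> nat \<Rightarrow> artin_word set" where
  "descending_prod n i k = braid_prod n (map (artin_gen n) (rev [i..<k]))"

definition band :: "nat \<Rightarrow> nat \<Rightarrow> nat \<Rightarrow> artin_word set" where
  "band n i j = descending_prod n (i + 1) j \<otimes>\<^bsub>braid_group n\<^esub> artin_gen n i
     \<otimes>\<^bsub>braid_group n\<^esub> inv\<^bsub>braid_group n\<^esub> (descending_prod n (i + 1) j)"

text \<open>In a letter \<open>((i, j), s)\<close>, the flag \<open>s\<close> is \<open>True\<close> for the band generator itself and
  \<open>False\<close> for its inverse.\<close>

type_synonym band_word = "((nat \<times> nat) \<times> bool) list"

definition band_words :: "nat \<Rightarrow> band_word set" where
  "band_words n = lists ({(i, j). 1 \<le> i \<and> i < j \<and> j \<le> n} \<times> UNIV)"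

fun signed_band :: "nat \<Rightarrow> (nat \<times> nat) \<times> bool \<Rightarrow> artin_word set" where
  "signed_band n ((i, j), s) = (if s then band n i j else inv\<^bsub>braid_group n\<^esub> (band n i j))"

definition braid_of :: "nat \<Rightarrow> band_word \<Rightarrow> artin_word set" where
  "braid_of n W = braid_prod n (map (signed_band n) W)"

definition word_nb :: "band_word \<Rightarrow> nat" where
  "word_nb W = length (filter (\<lambda>x. \<not> snd x) W)"

definition word_writhe :: "band_word \<Rightarrow> int" where
  "word_writhe W = int (length (filter snd W)) - int (length (filter (\<lambda>x. \<not> snd x) W))"

definition nb :: "nat \<Rightarrow> artin_word set \<Rightarrow> nat" where
  "nb n \<beta> = (LEAST k. \<exists>W\<in>band_words n. braid_of n W = \<beta> \<and> word_nb W = k)"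

text \<open>Independence of the representing word is shown in \<open>writhe_braid_of\<close> below.\<close>

definition writhe :: "nat \<Rightarrow> artin_word set \<Rightarrow> int" where
  "writhe n \<beta> = (THE e. \<exists>W\<in>band_words n. braid_of n W = \<beta> \<and> word_writhe W = e)"

section \<open>The order, infimum and supremum\<close>

definition SQP :: "nat \<Rightarrow> artin_word set set" where
  "SQP n = {braid_of n W | W. W \<in> band_words n \<and> (\<forall>x\<in>set W. snd x)}"

definition braid_le :: "nat \<Rightarrow> artin_word set \<Rightarrow> artin_word set \<Rightarrow> bool" where
  "braid_le n V W \<longleftrightarrow>
    (\<exists>P\<in>SQP n. \<exists>Q\<in>SQP n. W = P \<otimes>\<^bsub>braid_group n\<^esub> V \<otimes>\<^bsub>braid_group n\<^esub> Q)"

definition \<delta> :: "nat \<Rightarrow> artin_word set" where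
  "\<delta> n = descending_prod n 1 n"

definition braid_inf :: "nat \<Rightarrow> artin_word set \<Rightarrow> int" where
  "braid_inf n \<beta> = (GREATEST r. braid_le n (\<delta> n [^]\<^bsub>braid_group n\<^esub> (r :: int)) \<beta>)"

definition braid_sup :: "nat \<Rightarrow> artin_word set \<Rightarrow> int" where
  "braid_sup n \<beta> = (LEAST s. braid_le n \<beta> (\<delta> n [^]\<^bsub>braid_group n\<^esub> (s :: int)))"

section \<open>Well-definedness\<close>

abbreviation braid_class :: "nat \<Rightarrow> artin_word \<Rightarrow> artin_word set" where
  "braid_class n w \<equiv> artin_rel n `` {w}"

lemma artin_eq_words: "artin_eq n u v \<Longrightarrow> u \<in> artin_words n \<and> v \<in> artin_words n"
  by (induction rule: artin_eq.induct) (auto simp: artin_words_def)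

lemma equiv_artin_rel: "equiv (artin_words n) (artin_rel n)"
proof (rule equivI)
  show "artin_rel n \<subseteq> artin_words n \<times> artin_words n"
    by (auto simp: artin_rel_def dest: artin_eq_words)
  show "refl_on (artin_words n) (artin_rel n)"
    by (auto simp: refl_on_def artin_rel_def intro: artin_refl)
  show "sym (artin_rel n)"
    by (auto intro!: symI simp: artin_rel_def intro: artin_sym)
  show "trans (artin_rel n)"
    by (rule transI) (auto simp: artin_rel_def intro: artin_trans)
qed

lemma braid_class_eq_iff:
  "u \<in> artin_words n \<Longrightarrow> v \<in> artin_words n \<Longrightarrow>
    braid_class n u = braid_class n v \<longleftrightarrow> artin_eq n u v"
  using eq_equiv_class_iff[OF equiv_artin_rel] by (auto simp: artin_rel_def)

lemma braid_class_carrier [simp]: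
  "w \<in> artin_words n \<Longrightarrow> braid_class n w \<in> carrier (braid_group n)"
  by (auto simp: braid_group_def intro: quotientI)

lemma carrier_braid_groupE:
  assumes "\<beta> \<in> carrier (braid_group n)"
  obtains w where "w \<in> artin_words n" "\<beta> = braid_class n w"
  using assms by (auto simp: braid_group_def elim: quotientE)

lemma append_artin_words [simp]:
  "u @ v \<in> artin_words n \<longleftrightarrow> u \<in> artin_words n \<and> v \<in> artin_words n"
  by (auto simp: artin_words_def)

lemma Nil_artin_words [simp]: "[] \<in> artin_words n"
  by (simp add: artin_words_def)

lemma mult_braid_class [simp]:
  assumes "u \<in> artin_words n" "v \<in> artin_words n"
  shows "braid_class n u \<otimes>\<^bsub>braid_group n\<^esub> braid_class n v = braid_class n (u @ v)"
proof -
  have *: "artin_rel n `` {u' @ v'} = braid_class n (u @ v)"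
    if "u' \<in> braid_class n u" "v' \<in> braid_class n v" for u' v'
  proof -
    have "artin_eq n (u @ v) (u' @ v')"
      using that by (auto simp: artin_rel_def intro: artin_append)
    then have "(u @ v, u' @ v') \<in> artin_rel n"
      by (simp add: artin_rel_def)
    then show ?thesis
      by (rule equiv_class_eq[OF equiv_artin_rel, symmetric])
  qed
  have "(\<Union>u'\<in>braid_class n u. \<Union>v'\<in>braid_class n v. artin_rel n `` {u' @ v'}) =
      (\<Union>u'\<in>braid_class n u. \<Union>v'\<in>braid_class n v. braid_class n (u @ v))"
    by (rule SUP_cong[OF refl], rule SUP_cong[OF refl], rule *)
  moreover have "u \<in> braid_class n u" "v \<in> braid_class n v"
    using assms by (auto simp: artin_rel_def intro: artin_refl)
  then have "braid_class n u \<noteq> {}" "braid_class n v \<noteq> {}"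
    by blast+
  ultimately show ?thesis
    by (simp only: braid_group_def monoid.simps UN_constant if_False)
qed

lemma one_braid_group: "\<one>\<^bsub>braid_group n\<^esub> = braid_class n []"
  by (simp add: braid_group_def)

definition inverse_word :: "artin_word \<Rightarrow> artin_word" where
  "inverse_word w = rev (map (\<lambda>(i, s). (i, \<not> s)) w)"

lemma inverse_word_words [simp]: "w \<in> artin_words n \<Longrightarrow> inverse_word w \<in> artin_words n"
  by (auto simp: artin_words_def inverse_word_def lists_eq_set)

lemma artin_eq_inverse_word:
  "w \<in> artin_words n \<Longrightarrow> artin_eq n (inverse_word w @ w) []"
proof (induction w)
  case Nil
  then show ?case by (auto simp: inverse_word_def intro: artin_refl)
next
  case (Cons a w)
  obtain i s where a: "a = (i, s)" by (cases a)
  have w: "w \<in> artin_words n" and i: "1 \<le> i" "i < n"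
    using Cons.prems a by (auto simp: artin_words_def)
  have "artin_eq n [(i, \<not> s), (i, s)] []"
    using artin_cancel[OF i, of "\<not> s"] by simp
  then have "artin_eq n (inverse_word w @ [(i, \<not> s), (i, s)] @ w) (inverse_word w @ [] @ w)"
    using w by (intro artin_append artin_refl) auto
  then have "artin_eq n (inverse_word (a # w) @ a # w) (inverse_word w @ w)"
    by (simp add: inverse_word_def a)
  then show ?case
    using Cons.IH[OF w] by (rule artin_trans)
qed

lemma group_braid_group: "group (braid_group n)"
proof (rule groupI)
  fix x assume "x \<in> carrier (braid_group n)"
  then obtain w where w: "w \<in> artin_words n" "x = braid_class n w"
    by (rule carrier_braid_groupE)
  then have "braid_class n (inverse_word w) \<otimes>\<^bsub>braid_group n\<^esub> x = \<one>\<^bsub>braid_group n\<^esub>"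
    by (simp add: one_braid_group braid_class_eq_iff artin_eq_inverse_word)
  with w show "\<exists>y\<in>carrier (braid_group n). y \<otimes>\<^bsub>braid_group n\<^esub> x = \<one>\<^bsub>braid_group n\<^esub>"
    by (metis braid_class_carrier inverse_word_words)
next
  fix x y assume "x \<in> carrier (braid_group n)" "y \<in> carrier (braid_group n)"
  then show "x \<otimes>\<^bsub>braid_group n\<^esub> y \<in> carrier (braid_group n)"
    by (elim carrier_braid_groupE) simp
next
  fix x y z
  assume "x \<in> carrier (braid_group n)" "y \<in> carrier (braid_group n)" "z \<in> carrier (braid_group n)"
  then show "x \<otimes>\<^bsub>braid_group n\<^esub> y \<otimes>\<^bsub>braid_group n\<^esub> z = x \<otimes>\<^bsub>braid_group n\<^esub> (y \<otimes>\<^bsub>braid_group n\<^esub> z)"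
    by (elim carrier_braid_groupE) simp
next
  fix x assume "x \<in> carrier (braid_group n)"
  then show "\<one>\<^bsub>braid_group n\<^esub> \<otimes>\<^bsub>braid_group n\<^esub> x = x"
    by (elim carrier_braid_groupE) (simp add: one_braid_group)
qed (simp add: one_braid_group)

lemma inv_braid_class:
  "w \<in> artin_words n \<Longrightarrow> inv\<^bsub>braid_group n\<^esub> braid_class n w = braid_class n (inverse_word w)"
  by (intro group.inv_equality[OF group_braid_group])
     (auto simp: one_braid_group braid_class_eq_iff artin_eq_inverse_word)

definition exponent_sum :: "artin_word \<Rightarrow> int" where
  "exponent_sum w = (\<Sum>(i, s)\<leftarrow>w. if s then 1 else - 1)"

lemma exponent_sum_cong: "artin_eq n u v \<Longrightarrow> exponent_sum u = exponent_sum v"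
  by (induction rule: artin_eq.induct) (auto simp: exponent_sum_def)

lemma exponent_sum_append [simp]: "exponent_sum (u @ v) = exponent_sum u + exponent_sum v"
  by (simp add: exponent_sum_def)

lemma exponent_sum_inverse [simp]: "exponent_sum (inverse_word w) = - exponent_sum w"
  by (induction w) (auto simp: exponent_sum_def inverse_word_def)

lemma braid_prod_Nil: "braid_prod n [] = braid_class n []"
  by (simp add: braid_prod_def one_braid_group)

lemma braid_prod_Cons: "braid_prod n (x # xs) = x \<otimes>\<^bsub>braid_group n\<^esub> braid_prod n xs"
  by (simp add: braid_prod_def)

lemma descending_prod_class:
  assumes "1 \<le> i" "k \<le> n"
  shows "\<exists>w\<in>artin_words n. descending_prod n i k = braid_class n w"
proof -
  have "\<exists>w\<in>artin_words n. braid_prod n (map (artin_gen n) xs) = braid_class n w"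
    if "set xs \<subseteq> {1..<n}" for xs
    using that
  proof (induction xs)
    case Nil
    then show ?case by (intro bexI[of _ "[]"]) (simp_all add: braid_prod_Nil)
  next
    case (Cons x xs)
    then obtain w where "w \<in> artin_words n" "braid_prod n (map (artin_gen n) xs) = braid_class n w"
      by auto
    moreover have "[(x, True)] \<in> artin_words n"
      using Cons.prems by (auto simp: artin_words_def)
    ultimately show ?case
      by (intro bexI[of _ "[(x, True)] @ w"])
         (simp_all add: braid_prod_Cons artin_gen_def[of n x] del: append.simps)
  qed
  from this[of "rev [i..<k]"] show ?thesis
    using assms by (auto simp: descending_prod_def)
qed

lemma signed_band_class:
  assumes "1 \<le> i" "i < j" "j \<le> n"
  shows "\<exists>w\<in>artin_words n. signed_band n ((i, j), s) = braid_class n w \<and>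
    exponent_sum w = (if s then 1 else - 1)"
proof -
  obtain w where w: "w \<in> artin_words n" "descending_prod n (i + 1) j = braid_class n w"
    using descending_prod_class[of "i + 1" j n] assms by auto
  let ?b = "(w @ [(i, True)]) @ inverse_word w"
  have i: "[(i, True)] \<in> artin_words n"
    using assms by (auto simp: artin_words_def)
  have b: "?b \<in> artin_words n" "band n i j = braid_class n ?b" "exponent_sum ?b = 1"
    using w i by (simp_all add: band_def artin_gen_def inv_braid_class del: append_assoc)
       (simp add: exponent_sum_def)
  show ?thesis
  proof (cases s)
    case True
    then show ?thesis using b by auto
  next
    case False
    then show ?thesis
      using b by (intro bexI[of _ "inverse_word ?b"]) (simp_all add: inv_braid_class del: append_assoc append_artin_words)
  qed
qed

lemma braid_of_class:
  "W \<in> band_words n \<Longrightarrow>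
    \<exists>w\<in>artin_words n. braid_of n W = braid_class n w \<and> exponent_sum w = word_writhe W"
proof (induction W)
  case Nil
  then show ?case
    by (intro bexI[of _ "[]"])
       (simp_all add: braid_of_def braid_prod_Nil exponent_sum_def word_writhe_def)
next
  case (Cons x W)
  obtain i j s where x: "x = ((i, j), s)" by (metis surj_pair)
  have ij: "1 \<le> i" "i < j" "j \<le> n" and W: "W \<in> band_words n"
    using Cons.prems x by (auto simp: band_words_def)
  obtain w where w: "w \<in> artin_words n" "braid_of n W = braid_class n w"
    "exponent_sum w = word_writhe W"
    using Cons.IH[OF W] by auto
  obtain v where v: "v \<in> artin_words n" "signed_band n x = braid_class n v"
    "exponent_sum v = (if s then 1 else - 1)"
    using signed_band_class[OF ij, of s] x by auto
  have "braid_of n (x # W) = braid_class n (v @ w)"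
    using v w by (simp add: braid_of_def braid_prod_Cons)
  moreover have "exponent_sum (v @ w) = word_writhe (x # W)"
    using v w x by (simp add: word_writhe_def)
  ultimately show ?case
    using v(1) w(1) by (intro bexI[of _ "v @ w"]) simp_all
qed

lemma braid_of_carrier: "W \<in> band_words n \<Longrightarrow> braid_of n W \<in> carrier (braid_group n)"
  using braid_of_class braid_class_carrier by metis

lemma writhe_braid_of:
  assumes "W \<in> band_words n"
  shows "writhe n (braid_of n W) = word_writhe W"
  unfolding writhe_def
proof (rule the_equality)
  show "\<exists>W'\<in>band_words n. braid_of n W' = braid_of n W \<and> word_writhe W' = word_writhe W"
    using assms by auto
next
  fix e assume "\<exists>W'\<in>band_words n. braid_of n W' = braid_of n W \<and> word_writhe W' = e"
  then obtain W' where W': "W' \<in> band_words n" "braid_of n W' = braid_of n W" "word_writhe W' = e"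
    by blast
  obtain w where w: "w \<in> artin_words n" "braid_of n W = braid_class n w"
    "exponent_sum w = word_writhe W"
    using braid_of_class[OF assms] by auto
  obtain w' where w': "w' \<in> artin_words n" "braid_of n W' = braid_class n w'"
    "exponent_sum w' = word_writhe W'"
    using braid_of_class[OF W'(1)] by auto
  have "artin_eq n w' w"
    using w w' W' by (simp flip: braid_class_eq_iff)
  then show "e = word_writhe W"
    using exponent_sum_cong w w' W' by simp
qed

lemma signed_band_artin:
  assumes "1 \<le> i" "i < n"
  shows "signed_band n ((i, i + 1), s) = braid_class n [(i, s)]"
proof -
  have i: "[(i, True)] \<in> artin_words n"
    using assms by (auto simp: artin_words_def)
  have inv: "inverse_word [] = []" "inverse_word [(i, True)] = [(i, False)]"
    by (simp_all add: inverse_word_def)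
  have "band n i (i + 1) = braid_class n [(i, True)]"
    using i by (simp add: band_def descending_prod_def braid_prod_Nil inv_braid_class artin_gen_def inv)
  then show ?thesis
    using i by (cases s) (simp_all add: inv_braid_class inv)
qed

lemma braid_of_surj:
  assumes "\<beta> \<in> carrier (braid_group n)"
  obtains W where "W \<in> band_words n" "braid_of n W = \<beta>"
proof -
  have "\<exists>W\<in>band_words n. braid_of n W = braid_class n w" if "w \<in> artin_words n" for w
    using that
  proof (induction w)
    case Nil
    then show ?case
      by (intro bexI[of _ "[]"]) (simp_all add: braid_of_def braid_prod_Nil band_words_def)
  next
    case (Cons a w)
    obtain i s where a: "a = (i, s)" by (cases a)
    have w: "w \<in> artin_words n" and i: "1 \<le> i" "i < n"
      using Cons.prems a by (auto simp: artin_words_def)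
    obtain W where W: "W \<in> band_words n" "braid_of n W = braid_class n w"
      using Cons.IH[OF w] by auto
    have "[a] \<in> artin_words n"
      using a i by (auto simp: artin_words_def)
    then have "braid_of n (((i, i + 1), s) # W) = braid_class n ([(i, s)] @ w)"
      using W w a signed_band_artin[OF i, of s]
      by (simp add: braid_of_def braid_prod_Cons del: signed_band.simps append.simps)
    then have "braid_of n (((i, i + 1), s) # W) = braid_class n (a # w)"
      using a by simp
    moreover have "((i, i + 1), s) # W \<in> band_words n"
      using W i by (auto simp: band_words_def)
    ultimately show ?case by blast
  qed
  then show thesis
    using carrier_braid_groupE[OF assms] that by metis
qed

end

theory Submission
  imports Defs
begin

text \<open>Write \<open>\<beta> = \<delta>\<^sup>r P\<close> with \<open>r = inf \<beta>\<close> and \<open>P\<close> a product of \<open>m\<close> bands. Conjugation by \<open>\<delta>\<close>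
  permutes the bands and every band divides \<open>\<delta>\<close>, so \<open>P\<close> divides \<open>\<delta>\<^sup>m\<close> and \<open>sup \<beta> \<le> r + m\<close>. If
  \<open>r < 0 < sup \<beta>\<close>, each of the \<open>\<bar>r\<bar>\<close> factors \<open>\<delta>\<^sup>-\<^sup>1\<close> can absorb one band of \<open>P\<close>, leaving \<open>n - 2\<close>
  negative bands; if \<open>sup \<beta> \<le> 0\<close>, then \<open>\<beta>\<^sup>-\<^sup>1\<close> is a positive word and counting exponents suffices.
  Conversely a negative band is \<open>\<delta>\<^sup>-\<^sup>1\<close> times a positive word, so \<open>\<bar>r\<bar> \<le> nb \<beta>\<close>, which is sharp
  for \<open>n = 3\<close>. Equality in the second part for \<open>n = 3\<close> means \<open>sup \<beta> = r + m\<close>; it follows from an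
  action of the braid group on normal forms \<open>w \<delta>\<^sup>k\<close>, under which positive letters never decrease
  \<open>length w + k\<close>.\<close>

section \<open>Attained extrema of bounded integer predicates\<close>

lemma int_Greatest:
  fixes R :: "int \<Rightarrow> bool"
  assumes "\<exists>x. R x" and bound: "\<And>x. R x \<Longrightarrow> x \<le> b"
  shows "R (GREATEST x. R x)" and "R y \<Longrightarrow> y \<le> (GREATEST x. R x)"
proof -
  obtain x where x: "R x" using assms(1) by blast
  \<comment> \<open>Only finitely many integers lie between the witness \<open>x\<close> and the
    bound, so a maximum exists there; solutions below \<open>x\<close> cannot compete with
    it.\<close>
  let ?S = "{x..b} \<inter> Collect R"
  have "x \<in> ?S"
    using x bound by simp
  then have S: "finite ?S" "?S \<noteq> {}"
    by blast+
  have "R (Max ?S)"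
    using Max_in[OF S] by simp
  moreover have max: "y \<le> Max ?S" if "R y" for y
  proof (cases "x \<le> y")
    case True
    then show ?thesis using that bound S by (intro Max_ge) auto
  next
    case False
    moreover have "x \<le> Max ?S" using x bound S by (intro Max_ge) auto
    ultimately show ?thesis by simp
  qed
  ultimately have "(GREATEST x. R x) = Max ?S"
    by (intro Greatest_equality) auto
  with \<open>R (Max ?S)\<close> max show "R (GREATEST x. R x)" "R y \<Longrightarrow> y \<le> (GREATEST x. R x)"
    by simp_all
qed

lemma int_Least:
  fixes R :: "int \<Rightarrow> bool"
  assumes "\<exists>x. R x" and bound: "\<And>x. R x \<Longrightarrow> b \<le> x"
  shows "R (LEAST x. R x)" and "R y \<Longrightarrow> (LEAST x. R x) \<le> y"
proof -
  obtain x where x: "R x" using assms(1) by blast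
  let ?S = "{b..x} \<inter> Collect R"
  have "x \<in> ?S"
    using x bound by simp
  then have S: "finite ?S" "?S \<noteq> {}"
    by blast+
  have "R (Min ?S)"
    using Min_in[OF S] by simp
  moreover have min: "Min ?S \<le> y" if "R y" for y
  proof (cases "y \<le> x")
    case True
    then show ?thesis using that bound S by (intro Min_le) auto
  next
    case False
    moreover have "Min ?S \<le> x" using x bound S by (intro Min_le) auto
    ultimately show ?thesis by simp
  qed
  ultimately have "(LEAST x. R x) = Min ?S"
    by (intro Least_equality) auto
  with \<open>R (Min ?S)\<close> min show "R (LEAST x. R x)" "R y \<Longrightarrow> (LEAST x. R x) \<le> y"
    by simp_all
qed

section \<open>Rotation of the band generators\<close>

text \<open>The group stays a parameter \<open>G\<close>, tied to \<open>braid_group n\<close> by an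
  equation: group lemmas and notation apply to \<open>G\<close>, and \<open>G_def\<close> leads back
  to classes of words where the presentation matters.\<close>

locale braid_monoid = group G for G (structure) +
  fixes n :: nat
  assumes G_def: "G = braid_group n"
begin

abbreviation gen :: "nat \<Rightarrow> artin_word set" where "gen \<equiv> artin_gen n"
abbreviation desc :: "nat \<Rightarrow> nat \<Rightarrow> artin_word set" where "desc \<equiv> descending_prod n"

lemma gen_class: "1 \<le> i \<Longrightarrow> i < n \<Longrightarrow> [(i, True)] \<in> artin_words n"
  by (auto simp: artin_words_def)

lemma gen_closed [simp]: "1 \<le> i \<Longrightarrow> i < n \<Longrightarrow> gen i \<in> carrier G"
  by (simp add: G_def artin_gen_def gen_class)

lemma gen_commute:
  assumes "1 \<le> i" "i + 2 \<le> j" "j < n"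
  shows "gen i \<otimes> gen j = gen j \<otimes> gen i"
  using assms artin_commute[OF assms]
  by (simp add: G_def artin_gen_def gen_class braid_class_eq_iff del: append_artin_words)
     (simp add: artin_words_def braid_class_eq_iff)

lemma gen_braid:
  assumes "1 \<le> i" "i + 1 < n"
  shows "gen i \<otimes> gen (i + 1) \<otimes> gen i = gen (i + 1) \<otimes> gen i \<otimes> gen (i + 1)"
proof -
  have "[(i, True), (i + 1, True)] \<in> artin_words n" "[(i + 1, True), (i, True)] \<in> artin_words n"
    "[(i, True)] \<in> artin_words n" "[(i + 1, True)] \<in> artin_words n"
    "[(i, True), (i + 1, True), (i, True)] \<in> artin_words n"
    "[(i + 1, True), (i, True), (i + 1, True)] \<in> artin_words n"
    using assms by (auto simp: artin_words_def)
  then show ?thesis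
    using artin_braid[OF assms] by (simp add: G_def artin_gen_def braid_class_eq_iff)
qed

lemma braid_prod_closed: "set xs \<subseteq> carrier G \<Longrightarrow> braid_prod n xs \<in> carrier G"
  by (induction xs) (simp_all add: braid_prod_def flip: G_def)

lemma braid_prod_append:
  "set xs \<subseteq> carrier G \<Longrightarrow> set ys \<subseteq> carrier G \<Longrightarrow>
    braid_prod n (xs @ ys) = braid_prod n xs \<otimes> braid_prod n ys"
proof (induction xs)
  case Nil
  then show ?case using braid_prod_closed[of ys] by (simp add: braid_prod_def flip: G_def)
next
  case (Cons x xs)
  then show ?case
    using braid_prod_closed[of ys] braid_prod_closed[of xs]
    by (simp add: braid_prod_Cons m_assoc flip: G_def)
qed

lemma desc_gens: "1 \<le> i \<Longrightarrow> k \<le> n \<Longrightarrow> set (map gen (rev [i..<k])) \<subseteq> carrier G"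
  by auto

lemma desc_closed [simp]: "1 \<le> i \<Longrightarrow> k \<le> n \<Longrightarrow> desc i k \<in> carrier G"
  unfolding descending_prod_def by (rule braid_prod_closed[OF desc_gens])

lemma desc_empty [simp]: "k \<le> i \<Longrightarrow> desc i k = \<one>"
  by (simp add: descending_prod_def braid_prod_def G_def)

lemma desc_split:
  assumes "1 \<le> i" "i \<le> j" "j \<le> k" "k \<le> n"
  shows "desc i k = desc j k \<otimes> desc i j"
proof -
  have "rev [i..<k] = rev [j..<k] @ rev [i..<j]"
    using assms by (metis le_Suc_ex rev_append upt_add_eq_append)
  moreover have "set (map gen (rev [j..<k])) \<subseteq> carrier G" "set (map gen (rev [i..<j])) \<subseteq> carrier G"
    using desc_gens[of j k] desc_gens[of i j] assms by simp_all
  ultimately show ?thesis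
    unfolding descending_prod_def by (metis braid_prod_append map_append)
qed

lemma desc_single: "1 \<le> i \<Longrightarrow> i < n \<Longrightarrow> desc i (Suc i) = gen i"
  by (simp add: descending_prod_def braid_prod_def flip: G_def)

lemma desc_commute:
  assumes "x \<in> carrier G" "1 \<le> i" "k \<le> n" "i \<le> k"
    and "\<And>p. i \<le> p \<Longrightarrow> p < k \<Longrightarrow> x \<otimes> gen p = gen p \<otimes> x"
  shows "x \<otimes> desc i k = desc i k \<otimes> x"
  using assms(4,3,5)
proof (induction k rule: dec_induct)
  case base
  then show ?case using assms by simp
next
  case (step k)
  have c: "gen k \<in> carrier G" "desc i k \<in> carrier G"
    using step assms by auto
  have "desc i (Suc k) = gen k \<otimes> desc i k"
    using desc_split[of i k "Suc k"] desc_single[of k] step assms by simp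
  moreover have "x \<otimes> (gen k \<otimes> desc i k) = gen k \<otimes> desc i k \<otimes> x"
  proof -
    have "x \<otimes> (gen k \<otimes> desc i k) = gen k \<otimes> x \<otimes> desc i k"
      using c assms step by (simp flip: m_assoc)
    also have "\<dots> = gen k \<otimes> (desc i k \<otimes> x)"
      using c assms step by (simp add: m_assoc)
    finally show ?thesis using c assms by (simp add: m_assoc)
  qed
  ultimately show ?case by simp
qed

text \<open>Write \<open>desc 1 j\<close> as \<open>A b a B\<close> with \<open>a = gen i\<close>
  and \<open>b = gen (Suc i)\<close>. The indices in \<open>B\<close> are far from that of
  \<open>b\<close> and those in \<open>A\<close> far from that of \<open>a\<close>, so
  \<open>b\<close> enters from the right, the braid relation turns \<open>b a b\<close> into
  \<open>a b a\<close>, and \<open>a\<close> leaves on the left.\<close>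

lemma desc_shift_gen:
  assumes "1 \<le> i" "Suc i < j" "j \<le> n"
  shows "desc 1 j \<otimes> gen (Suc i) = gen i \<otimes> desc 1 j"
proof -
  define A where "A = desc (i + 2) j"
  define B where "B = desc 1 i"
  define a where "a = gen i"
  define b where "b = gen (Suc i)"
  have c: "A \<in> carrier G" "B \<in> carrier G" "a \<in> carrier G" "b \<in> carrier G"
    using assms by (auto simp: A_def B_def a_def b_def)
  have "desc 1 j = A \<otimes> desc 1 (i + 2)"
    unfolding A_def using assms by (intro desc_split) auto
  also have "desc 1 (i + 2) = desc (Suc i) (i + 2) \<otimes> desc 1 (Suc i)"
    using assms by (intro desc_split) auto
  also have "desc 1 (Suc i) = a \<otimes> B"
    using assms desc_split[of 1 i "Suc i"] desc_single[of i] by (simp add: a_def B_def)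
  also have "desc (Suc i) (i + 2) = b"
    using assms desc_single[of "Suc i"] by (simp add: b_def)
  finally have D: "desc 1 j = A \<otimes> (b \<otimes> (a \<otimes> B))" .
  have aA: "a \<otimes> A = A \<otimes> a"
    unfolding A_def a_def using assms by (intro desc_commute gen_commute) auto
  have bB: "b \<otimes> B = B \<otimes> b"
    unfolding B_def b_def using assms by (intro desc_commute gen_commute[symmetric]) auto
  have aba: "a \<otimes> b \<otimes> a = b \<otimes> a \<otimes> b"
    unfolding a_def b_def using gen_braid[of i] assms by simp
  have "A \<otimes> (b \<otimes> (a \<otimes> B)) \<otimes> b = A \<otimes> (b \<otimes> a \<otimes> (B \<otimes> b))"
    using c by (simp add: m_assoc)
  also have "\<dots> = A \<otimes> (b \<otimes> a \<otimes> b) \<otimes> B"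
    using c by (simp add: m_assoc flip: bB)
  also have "\<dots> = A \<otimes> a \<otimes> (b \<otimes> (a \<otimes> B))"
    using c by (simp add: m_assoc flip: aba)
  also have "\<dots> = a \<otimes> (A \<otimes> (b \<otimes> (a \<otimes> B)))"
    using c by (simp add: m_assoc flip: aA)
  finally show ?thesis
    unfolding D by (simp add: a_def b_def)
qed

text \<open>Generators are shifted one at a time. The prefix \<open>desc 1 j\<close> is kept general
  because the wrap-around case of the rotation needs \<open>j = Suc i\<close>, not only
  \<open>j = n\<close>.\<close>

lemma desc_shift:
  assumes "i \<le> k" "1 \<le> i" "Suc k \<le> j" "j \<le> n"
  shows "desc 1 j \<otimes> desc (Suc i) (Suc k) = desc i k \<otimes> desc 1 j"
  using assms
proof (induction k rule: dec_induct)
  case base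
  then show ?case by simp
next
  case (step k)
  have c: "desc 1 j \<in> carrier G" "desc (Suc i) (Suc k) \<in> carrier G" "desc i k \<in> carrier G"
    "gen k \<in> carrier G" "gen (Suc k) \<in> carrier G"
    using step by auto
  have D: "desc (Suc i) (Suc (Suc k)) = gen (Suc k) \<otimes> desc (Suc i) (Suc k)"
    "desc i (Suc k) = gen k \<otimes> desc i k"
    using desc_split[of "Suc i" "Suc k" "Suc (Suc k)"] desc_split[of i k "Suc k"]
      desc_single[of k] desc_single[of "Suc k"] step by simp_all
  have "desc 1 j \<otimes> desc (Suc i) (Suc (Suc k)) = desc 1 j \<otimes> gen (Suc k) \<otimes> desc (Suc i) (Suc k)"
    unfolding D using c by (simp add: m_assoc)
  also have "\<dots> = gen k \<otimes> (desc 1 j \<otimes> desc (Suc i) (Suc k))"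
    using desc_shift_gen[of k j] step c by (simp add: m_assoc)
  also have "\<dots> = desc i (Suc k) \<otimes> desc 1 j"
    unfolding D using step c by (simp add: m_assoc)
  finally show ?case .
qed

lemma delta_closed [simp]: "1 \<le> n \<Longrightarrow> \<delta> n \<in> carrier G"
  by (simp add: \<delta>_def)

lemma band_closed [simp]:
  assumes "1 \<le> i" "i < j" "j \<le> n"
  shows "band n i j \<in> carrier G"
  using assms unfolding band_def G_def[symmetric] by simp

text \<open>Clears the inverse in \<open>band\<close>: identities between bands become identities
  between descending products, which can be shifted, and cancelling on the right recovers
  them.\<close>

lemma band_desc:
  assumes "1 \<le> i" "i < j" "j \<le> n"
  shows "band n i j \<otimes> desc (Suc i) j = desc i j"
proof -
  have "desc i j = desc (Suc i) j \<otimes> gen i"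
    using desc_split[of i "Suc i" j] desc_single[of i] assms by simp
  then show ?thesis
    using assms unfolding band_def G_def[symmetric] by (simp add: m_assoc)
qed

text \<open>Conjugation by \<open>\<delta>\<close> rotates the punctures, \<open>i \<mapsto> i - 1\<close> modulo \<open>n\<close>.\<close>

lemma delta_band_Suc:
  assumes "1 \<le> i" "i < j" "Suc j \<le> n"
  shows "\<delta> n \<otimes> band n (Suc i) (Suc j) = band n i j \<otimes> \<delta> n"
proof -
  let ?b = "band n (Suc i) (Suc j)" and ?c = "band n i j"
  have c: "\<delta> n \<in> carrier G" "?b \<in> carrier G" "?c \<in> carrier G"
    "desc (Suc (Suc i)) (Suc j) \<in> carrier G" "desc (Suc i) j \<in> carrier G"
    using assms by auto
  have sh: "\<delta> n \<otimes> desc (Suc i) (Suc j) = desc i j \<otimes> \<delta> n"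
    "\<delta> n \<otimes> desc (Suc (Suc i)) (Suc j) = desc (Suc i) j \<otimes> \<delta> n"
    unfolding \<delta>_def using assms desc_shift[of i j n] desc_shift[of "Suc i" j n] by simp_all
  have "\<delta> n \<otimes> ?b \<otimes> desc (Suc (Suc i)) (Suc j) = \<delta> n \<otimes> desc (Suc i) (Suc j)"
    using c band_desc[of "Suc i" "Suc j"] assms by (simp add: m_assoc)
  also have "\<dots> = ?c \<otimes> (desc (Suc i) j \<otimes> \<delta> n)"
    unfolding sh using band_desc[of i j] c assms by (simp flip: m_assoc)
  also have "\<dots> = ?c \<otimes> \<delta> n \<otimes> desc (Suc (Suc i)) (Suc j)"
    using c by (simp add: m_assoc flip: sh(2))
  finally show ?thesis
    using c by simp
qed

text \<open>The wrap-around case, where puncture 1 moves to \<open>n\<close>. Cutting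
  \<open>\<delta>\<close> at \<open>i\<close> and at \<open>Suc i\<close> gives two factorizations,
  and \<open>desc_shift\<close> passes from one to the other.\<close>

lemma delta_band_1:
  assumes "1 \<le> i" "i < n"
  shows "\<delta> n \<otimes> band n 1 (Suc i) = band n i n \<otimes> \<delta> n"
proof -
  let ?j = "Suc i"
  have c: "\<delta> n \<in> carrier G" "band n 1 ?j \<in> carrier G" "band n i n \<in> carrier G"
    "desc 2 ?j \<in> carrier G" "desc ?j n \<in> carrier G" "desc 1 ?j \<in> carrier G"
    "desc 1 i \<in> carrier G" "desc i n \<in> carrier G"
    using assms by auto
  have d: "\<delta> n = desc ?j n \<otimes> desc 1 ?j" "\<delta> n = desc i n \<otimes> desc 1 i"
    unfolding \<delta>_def using assms desc_split[of 1 ?j n] desc_split[of 1 i n] by simp_all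
  have sh: "desc 1 ?j \<otimes> desc 2 ?j = desc 1 i \<otimes> desc 1 ?j"
    using desc_shift[of 1 i ?j] assms by (simp add: numeral_2_eq_2)
  have "\<delta> n \<otimes> band n 1 ?j \<otimes> desc 2 ?j = \<delta> n \<otimes> desc 1 ?j"
    using c band_desc[of 1 ?j] assms by (simp add: m_assoc numeral_2_eq_2)
  also have "\<dots> = desc i n \<otimes> (desc 1 ?j \<otimes> desc 2 ?j)"
    unfolding sh d(2) using c by (simp add: m_assoc)
  also have "\<dots> = band n i n \<otimes> (desc ?j n \<otimes> desc 1 ?j) \<otimes> desc 2 ?j"
    using c band_desc[of i n] assms by (simp flip: m_assoc)
  finally show ?thesis
    unfolding d(1)[symmetric] using c by simp
qed

abbreviation is_band :: "nat \<Rightarrow> nat \<Rightarrow> bool" where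
  "is_band i j \<equiv> 1 \<le> i \<and> i < j \<and> j \<le> n"

lemma delta_band:
  assumes "is_band i j"
  shows "\<exists>i' j'. is_band i' j' \<and> \<delta> n \<otimes> band n i j = band n i' j' \<otimes> \<delta> n"
proof (cases "i = 1")
  case True
  then show ?thesis
    using assms delta_band_1[of "j - 1"] by (intro exI[of _ "j - 1"] exI[of _ n]) auto
next
  case False
  then show ?thesis
    using assms delta_band_Suc[of "i - 1" "j - 1"]
    by (intro exI[of _ "i - 1"] exI[of _ "j - 1"]) auto
qed

lemma band_delta:
  assumes "is_band i j"
  shows "\<exists>i' j'. is_band i' j' \<and> band n i j \<otimes> \<delta> n = \<delta> n \<otimes> band n i' j'"
proof (cases "j = n")
  case True
  then show ?thesis
    using assms delta_band_1[of i] by (intro exI[of _ 1] exI[of _ "Suc i"]) auto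
next
  case False
  then show ?thesis
    using assms delta_band_Suc[of i j] by (intro exI[of _ "Suc i"] exI[of _ "Suc j"]) auto
qed

section \<open>Band words and the monoid of positive braids\<close>

lemma signed_band_closed [simp]: "is_band i j \<Longrightarrow> signed_band n ((i, j), s) \<in> carrier G"
  by (simp flip: G_def)

lemma band_words_Cons: "((i, j), s) # W \<in> band_words n \<longleftrightarrow> is_band i j \<and> W \<in> band_words n"
  by (auto simp: band_words_def)

lemma band_words_append: "V @ W \<in> band_words n \<longleftrightarrow> V \<in> band_words n \<and> W \<in> band_words n"
  by (auto simp: band_words_def)

lemma braid_of_closed [simp]: "W \<in> band_words n \<Longrightarrow> braid_of n W \<in> carrier G"
  by (simp add: G_def braid_of_carrier)

lemma braid_of_Nil [simp]: "braid_of n [] = \<one>"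
  by (simp add: braid_of_def braid_prod_def G_def)

lemma braid_of_Cons: "braid_of n (x # W) = signed_band n x \<otimes> braid_of n W"
  by (simp add: braid_of_def braid_prod_Cons G_def)

lemma braid_of_append:
  "V \<in> band_words n \<Longrightarrow> W \<in> band_words n \<Longrightarrow> braid_of n (V @ W) = braid_of n V \<otimes> braid_of n W"
proof (induction V)
  case (Cons x V)
  obtain i j s where x: "x = ((i, j), s)" by (metis surj_pair)
  with Cons show ?case
    by (simp add: braid_of_Cons band_words_Cons m_assoc del: signed_band.simps)
qed simp

lemma braid_wordE:
  assumes "x \<in> carrier G"
  obtains W where "W \<in> band_words n" "braid_of n W = x"
  using braid_of_surj[of x n] assms by (auto simp: G_def)

lemma SQP_closed [simp]: "P \<in> SQP n \<Longrightarrow> P \<in> carrier G"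
  by (auto simp: SQP_def)

lemma SQP_one [simp]: "\<one> \<in> SQP n"
  unfolding SQP_def by (auto intro!: exI[of _ "[]"] simp: band_words_def)

lemma SQP_mult [simp]: "P \<in> SQP n \<Longrightarrow> Q \<in> SQP n \<Longrightarrow> P \<otimes> Q \<in> SQP n"
proof -
  assume "P \<in> SQP n" "Q \<in> SQP n"
  then obtain V W where "V \<in> band_words n" "\<forall>x\<in>set V. snd x" "braid_of n V = P"
    "W \<in> band_words n" "\<forall>x\<in>set W. snd x" "braid_of n W = Q"
    by (auto simp: SQP_def)
  then show "P \<otimes> Q \<in> SQP n"
    unfolding SQP_def
    by (intro CollectI exI[of _ "V @ W"]) (simp add: braid_of_append band_words_append ball_Un)
qed

lemma SQP_band [simp]: "is_band i j \<Longrightarrow> band n i j \<in> SQP n"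
  unfolding SQP_def
  by (auto intro!: exI[of _ "[((i, j), True)]"] simp: braid_of_Cons band_words_Cons band_words_def)

text \<open>Peeling bands off a positive word from the left gives an induction on elements of the
  monoid, so that the words need not be carried along.\<close>

lemma SQP_induct [consumes 1, case_names one band]:
  assumes "P \<in> SQP n" and "R \<one>"
    and band: "\<And>i j Q. is_band i j \<Longrightarrow> Q \<in> SQP n \<Longrightarrow> R Q \<Longrightarrow> R (band n i j \<otimes> Q)"
  shows "R P"
proof -
  obtain W where W: "W \<in> band_words n" "\<forall>x\<in>set W. snd x" and P: "braid_of n W = P"
    using assms(1) by (auto simp: SQP_def)
  from W have "R (braid_of n W)"
  proof (induction W)
    case Nil
    then show ?case using assms by simp
  next
    case (Cons x W)
    obtain i j where x: "x = ((i, j), True)"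
      using Cons.prems by (metis list.set_intros(1) prod.collapse)
    have "braid_of n W \<in> SQP n"
      using Cons.prems by (auto simp: SQP_def band_words_def)
    with Cons x show ?case
      by (auto intro!: band simp: braid_of_Cons band_words_Cons)
  qed
  with P show ?thesis by simp
qed

section \<open>Writhe and negative band number on the group\<close>

lemma writhe_mult:
  assumes "x \<in> carrier G" "y \<in> carrier G"
  shows "writhe n (x \<otimes> y) = writhe n x + writhe n y"
proof -
  obtain V where V: "V \<in> band_words n" "braid_of n V = x"
    using assms(1) by (rule braid_wordE)
  obtain W where W: "W \<in> band_words n" "braid_of n W = y"
    using assms(2) by (rule braid_wordE)
  have "writhe n (x \<otimes> y) = word_writhe (V @ W)"
    using V W writhe_braid_of[of "V @ W" n] by (simp add: band_words_append braid_of_append)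
  also have "\<dots> = word_writhe V + word_writhe W"
    by (simp add: word_writhe_def)
  finally show ?thesis
    using V W writhe_braid_of[OF V(1)] writhe_braid_of[OF W(1)] by simp
qed

lemma writhe_one [simp]: "writhe n \<one> = 0"
  using writhe_mult[of \<one> \<one>] by simp

lemma writhe_inv: "x \<in> carrier G \<Longrightarrow> writhe n (inv x) = - writhe n x"
  using writhe_mult[of x "inv x"] by simp

lemma writhe_band [simp]:
  assumes "is_band i j"
  shows "writhe n (band n i j) = 1"
  using writhe_braid_of[of "[((i, j), True)]" n] assms
  by (simp add: braid_of_Cons band_words_Cons band_words_def word_writhe_def)

lemma SQP_writhe_nonneg: "P \<in> SQP n \<Longrightarrow> 0 \<le> writhe n P"
  by (induction rule: SQP_induct) (simp_all add: writhe_mult)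

text \<open>The identity has writhe 0, so some band comes first; it is the one that a factor
  \<open>inv (\<delta> n)\<close> will absorb.\<close>

lemma SQP_unfold:
  assumes "P \<in> SQP n" "0 < writhe n P"
  obtains i j Q where "is_band i j" "Q \<in> SQP n" "P = band n i j \<otimes> Q"
  using assms by (induction rule: SQP_induct) auto

lemma nb_wordE:
  assumes "x \<in> carrier G"
  obtains W where "W \<in> band_words n" "braid_of n W = x" "word_nb W = nb n x"
proof -
  obtain W where "W \<in> band_words n" "braid_of n W = x"
    using assms by (rule braid_wordE)
  then have "\<exists>k. \<exists>W\<in>band_words n. braid_of n W = x \<and> word_nb W = k"
    by blast
  then have "\<exists>W\<in>band_words n. braid_of n W = x \<and> word_nb W = nb n x"
    unfolding nb_def by (rule LeastI_ex)
  then show thesis using that by blast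
qed

lemma nb_le: "W \<in> band_words n \<Longrightarrow> nb n (braid_of n W) \<le> word_nb W"
  unfolding nb_def by (rule Least_le) blast

text \<open>Concatenate two words that realize the minimum.\<close>

lemma nb_mult_le:
  assumes "x \<in> carrier G" "y \<in> carrier G"
  shows "nb n (x \<otimes> y) \<le> nb n x + nb n y"
proof -
  obtain V where V: "V \<in> band_words n" "braid_of n V = x" "word_nb V = nb n x"
    using assms(1) by (rule nb_wordE)
  obtain W where W: "W \<in> band_words n" "braid_of n W = y" "word_nb W = nb n y"
    using assms(2) by (rule nb_wordE)
  have "word_nb (V @ W) = nb n x + nb n y"
    by (simp add: word_nb_def flip: V(3) W(3))
  then show ?thesis
    using nb_le[of "V @ W"] V W by (simp add: band_words_append braid_of_append)
qed

lemma nb_SQP: "P \<in> SQP n \<Longrightarrow> nb n P = 0"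
  unfolding SQP_def using nb_le by (fastforce simp: word_nb_def)

lemma nb_inv_band:
  assumes "is_band i j"
  shows "nb n (inv (band n i j)) \<le> 1"
  using nb_le[of "[((i, j), False)]"] assms
  by (simp add: braid_of_Cons band_words_Cons band_words_def word_nb_def flip: G_def)

text \<open>Reversing a positive word and inverting its letters yields one negative band for each
  unit of writhe.\<close>

lemma nb_inv_SQP: "P \<in> SQP n \<Longrightarrow> int (nb n (inv P)) \<le> writhe n P"
proof (induction rule: SQP_induct)
  case one
  then show ?case using nb_SQP[of \<one>] by simp
next
  case (band i j Q)
  then have "nb n (inv (band n i j \<otimes> Q)) \<le> nb n (inv Q) + nb n (inv (band n i j))"
    by (simp add: inv_mult_group nb_mult_le)
  with band nb_inv_band[of i j] show ?case
    by (simp add: writhe_mult)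
qed

text \<open>In any word the negated writhe is the number of negative bands less that of positive
  ones. This is the matching lower bound for inverses of positive braids.\<close>

lemma neg_writhe_le_nb:
  assumes "x \<in> carrier G"
  shows "- writhe n x \<le> int (nb n x)"
proof -
  obtain W where W: "W \<in> band_words n" "braid_of n W = x" "word_nb W = nb n x"
    using assms by (rule nb_wordE)
  have "- word_writhe W \<le> int (word_nb W)"
    by (simp add: word_writhe_def word_nb_def)
  then show ?thesis
    using writhe_braid_of[OF W(1)] W by simp
qed

lemma desc_SQP:
  assumes "i \<le> k" "1 \<le> i" "k \<le> n"
  shows "desc i k \<in> SQP n \<and> writhe n (desc i k) = int (k - i)"
  using assms
proof (induction k rule: dec_induct)
  case base
  then show ?case by simp
next
  case (step k)
  \<comment> \<open>The conjugator in \<open>band n k (Suc k)\<close> is an empty product, so this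
    band is an Artin generator.\<close>
  have g: "gen k = band n k (Suc k)"
    using band_desc[of k "Suc k"] desc_single[of k] step by simp
  have "desc i (Suc k) = gen k \<otimes> desc i k"
    using desc_split[of i k "Suc k"] desc_single[of k] step by simp
  then show ?case
    using step unfolding g by (auto simp: writhe_mult)
qed

subsection \<open>Powers of \<open>\<delta>\<close> and the positive monoid\<close>

lemma delta_SQP:
  assumes "1 \<le> n"
  shows "\<delta> n \<in> SQP n" and "writhe n (\<delta> n) = int n - 1"
  using desc_SQP[of 1 n] assms by (auto simp: \<delta>_def)

text \<open>\<open>\<delta>\<close> passes one band after another, rotating each into another band,
  so positivity survives.\<close>

lemma delta_SQP_commute:
  assumes "P \<in> SQP n" "1 \<le> n"
  shows "\<exists>Q\<in>SQP n. \<delta> n \<otimes> P = Q \<otimes> \<delta> n"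
  using assms(1)
proof (induction rule: SQP_induct)
  case one
  then show ?case using assms by (intro bexI[of _ \<one>]) auto
next
  case (band i j P)
  obtain Q where Q: "Q \<in> SQP n" "\<delta> n \<otimes> P = Q \<otimes> \<delta> n"
    using band by blast
  obtain i' j' where ij: "is_band i' j'" "\<delta> n \<otimes> band n i j = band n i' j' \<otimes> \<delta> n"
    using delta_band band by blast
  have "\<delta> n \<otimes> (band n i j \<otimes> P) = band n i' j' \<otimes> (\<delta> n \<otimes> P)"
    using ij band assms by (simp flip: m_assoc)
  also have "\<dots> = band n i' j' \<otimes> Q \<otimes> \<delta> n"
    using Q ij assms by (simp add: m_assoc)
  finally show ?case
    using Q ij by (intro bexI[of _ "band n i' j' \<otimes> Q"]) auto
qed

lemma SQP_delta_commute:
  assumes "P \<in> SQP n" "1 \<le> n"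
  shows "\<exists>Q\<in>SQP n. P \<otimes> \<delta> n = \<delta> n \<otimes> Q"
  using assms(1)
proof (induction rule: SQP_induct)
  case one
  then show ?case using assms by (intro bexI[of _ \<one>]) auto
next
  case (band i j P)
  obtain Q where Q: "Q \<in> SQP n" "P \<otimes> \<delta> n = \<delta> n \<otimes> Q"
    using band by blast
  obtain i' j' where ij: "is_band i' j'" "band n i j \<otimes> \<delta> n = \<delta> n \<otimes> band n i' j'"
    using band_delta band by blast
  have "band n i j \<otimes> P \<otimes> \<delta> n = band n i j \<otimes> \<delta> n \<otimes> Q"
    using Q ij(1) band assms by (simp add: m_assoc)
  also have "\<dots> = \<delta> n \<otimes> (band n i' j' \<otimes> Q)"
    unfolding ij(2) using Q(1) ij(1) assms by (simp add: m_assoc)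
  finally show ?case
    using Q ij by (intro bexI[of _ "band n i' j' \<otimes> Q"]) auto
qed

lemma delta_nat_pow_SQP_commute:
  assumes "P \<in> SQP n" "1 \<le> n"
  shows "\<exists>Q\<in>SQP n. \<delta> n [^] (k :: nat) \<otimes> P = Q \<otimes> \<delta> n [^] k"
  using assms(1)
proof (induction k arbitrary: P)
  case 0
  then show ?case by auto
next
  case (Suc k)
  obtain R where R: "R \<in> SQP n" "\<delta> n \<otimes> P = R \<otimes> \<delta> n"
    using delta_SQP_commute assms Suc.prems by blast
  obtain S where S: "S \<in> SQP n" "\<delta> n [^] k \<otimes> R = S \<otimes> \<delta> n [^] k"
    using Suc.IH R by blast
  have "\<delta> n [^] Suc k \<otimes> P = \<delta> n [^] k \<otimes> R \<otimes> \<delta> n"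
    using R Suc.prems assms by (simp add: m_assoc)
  also have "\<dots> = S \<otimes> \<delta> n [^] Suc k"
    using R S assms by (simp add: m_assoc)
  finally show ?case using S by blast
qed

lemma SQP_delta_nat_pow_commute:
  assumes "P \<in> SQP n" "1 \<le> n"
  shows "\<exists>Q\<in>SQP n. P \<otimes> \<delta> n [^] (k :: nat) = \<delta> n [^] k \<otimes> Q"
proof (induction k)
  case 0
  then show ?case using assms by auto
next
  case (Suc k)
  obtain R where R: "R \<in> SQP n" "P \<otimes> \<delta> n [^] k = \<delta> n [^] k \<otimes> R"
    using Suc.IH by blast
  obtain S where S: "S \<in> SQP n" "R \<otimes> \<delta> n = \<delta> n \<otimes> S"
    using SQP_delta_commute R assms by blast
  have "P \<otimes> \<delta> n [^] Suc k = \<delta> n [^] k \<otimes> R \<otimes> \<delta> n"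
    using R assms by (simp flip: m_assoc)
  also have "\<dots> = \<delta> n [^] Suc k \<otimes> S"
    using R S assms by (simp add: m_assoc)
  finally show ?case using S by blast
qed

lemma inv_commute:
  assumes "x \<in> carrier G" "p \<in> carrier G" "q \<in> carrier G" "p \<otimes> x = x \<otimes> q"
  shows "inv x \<otimes> p = q \<otimes> inv x"
proof -
  have "inv x \<otimes> p = inv x \<otimes> (p \<otimes> x) \<otimes> inv x"
    using assms(1-3) by (simp add: m_assoc)
  also have "\<dots> = q \<otimes> inv x"
    using assms(1-3) unfolding assms(4) by (simp flip: m_assoc)
  finally show ?thesis .
qed

lemma commute_inv:
  assumes "x \<in> carrier G" "p \<in> carrier G" "q \<in> carrier G" "x \<otimes> q = p \<otimes> x"
  shows "x \<otimes> inv q = inv p \<otimes> x"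
proof -
  have "x \<otimes> inv q = inv p \<otimes> (p \<otimes> x) \<otimes> inv q"
    using assms(1-3) by (simp flip: m_assoc)
  also have "\<dots> = inv p \<otimes> x"
    using assms(1-3) unfolding assms(4)[symmetric] by (simp add: m_assoc)
  finally show ?thesis .
qed

text \<open>For a negative exponent, commutation with the positive power in the other direction is
  read through \<open>inv_commute\<close>. Rotation keeps the writhe, as comparing both sides of the
  equation shows.\<close>

lemma delta_pow_SQP_commute:
  assumes "P \<in> SQP n" "1 \<le> n"
  obtains Q where "Q \<in> SQP n" "\<delta> n [^] (k :: int) \<otimes> P = Q \<otimes> \<delta> n [^] k"
    "writhe n Q = writhe n P"
proof -
  have "\<exists>Q\<in>SQP n. \<delta> n [^] k \<otimes> P = Q \<otimes> \<delta> n [^] k"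
  proof (cases k rule: int_cases2)
    case (nonneg m)
    then show ?thesis using delta_nat_pow_SQP_commute[OF assms, of m] by (simp add: int_pow_int)
  next
    case (nonpos m)
    obtain Q where "Q \<in> SQP n" "P \<otimes> \<delta> n [^] m = \<delta> n [^] m \<otimes> Q"
      using SQP_delta_nat_pow_commute[OF assms] by blast
    then show ?thesis
      using assms nonpos inv_commute[of "\<delta> n [^] m" P Q] by (auto simp: int_pow_neg_int)
  qed
  then obtain Q where Q: "Q \<in> SQP n" "\<delta> n [^] k \<otimes> P = Q \<otimes> \<delta> n [^] k"
    by blast
  moreover have "writhe n Q = writhe n P"
    using arg_cong[OF Q(2), of "writhe n"] Q(1) assms by (simp add: writhe_mult)
  ultimately show thesis using that by blast
qed

lemma SQP_delta_pow_commute: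
  assumes "P \<in> SQP n" "1 \<le> n"
  obtains Q where "Q \<in> SQP n" "P \<otimes> \<delta> n [^] (k :: int) = \<delta> n [^] k \<otimes> Q"
    "writhe n Q = writhe n P"
proof -
  obtain Q where Q: "Q \<in> SQP n" "\<delta> n [^] (- k) \<otimes> P = Q \<otimes> \<delta> n [^] (- k)"
    "writhe n Q = writhe n P"
    using delta_pow_SQP_commute assms by blast
  have "inv (\<delta> n [^] (- k)) \<otimes> Q = P \<otimes> inv (\<delta> n [^] (- k))"
    using Q assms by (intro inv_commute) auto
  then have "P \<otimes> \<delta> n [^] k = \<delta> n [^] k \<otimes> Q"
    using assms by (simp add: int_pow_neg)
  with Q that show thesis by blast
qed

lemma writhe_delta_nat_pow:
  "1 \<le> n \<Longrightarrow> writhe n (\<delta> n [^] (k :: nat)) = int k * (int n - 1)"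
  by (induction k) (simp_all add: writhe_mult delta_SQP algebra_simps)

lemma writhe_delta_pow:
  "1 \<le> n \<Longrightarrow> writhe n (\<delta> n [^] (k :: int)) = k * (int n - 1)"
  by (cases k rule: int_cases2)
     (simp_all add: int_pow_int int_pow_neg_int writhe_inv writhe_delta_nat_pow)

text \<open>The left positive factor can be carried through the power of \<open>\<delta>\<close>, so
  the two-sided order reduces to divisibility from one side.\<close>

lemma delta_pow_le_iff:
  assumes "1 \<le> n" "\<beta> \<in> carrier G"
  shows "braid_le n (\<delta> n [^] (r :: int)) \<beta> \<longleftrightarrow> (\<exists>P\<in>SQP n. \<beta> = \<delta> n [^] r \<otimes> P)"
proof
  assume "braid_le n (\<delta> n [^] r) \<beta>"
  then obtain P Q where PQ: "P \<in> SQP n" "Q \<in> SQP n" "\<beta> = P \<otimes> \<delta> n [^] r \<otimes> Q"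
    by (auto simp: braid_le_def G_def)
  obtain P' where "P' \<in> SQP n" "P \<otimes> \<delta> n [^] r = \<delta> n [^] r \<otimes> P'"
    using SQP_delta_pow_commute PQ(1) assms(1) by blast
  then show "\<exists>P\<in>SQP n. \<beta> = \<delta> n [^] r \<otimes> P"
    using PQ assms by (intro bexI[of _ "P' \<otimes> Q"]) (simp_all add: m_assoc)
next
  assume "\<exists>P\<in>SQP n. \<beta> = \<delta> n [^] r \<otimes> P"
  then obtain P where "P \<in> SQP n" "\<beta> = \<one> \<otimes> \<delta> n [^] r \<otimes> P"
    using assms by auto
  then show "braid_le n (\<delta> n [^] r) \<beta>"
    unfolding braid_le_def using SQP_one by (auto simp: G_def)
qed

lemma le_delta_pow_iff:
  assumes "1 \<le> n" "\<beta> \<in> carrier G"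
  shows "braid_le n \<beta> (\<delta> n [^] (s :: int)) \<longleftrightarrow> (\<exists>Q\<in>SQP n. \<delta> n [^] s = \<beta> \<otimes> Q)"
proof
  assume "braid_le n \<beta> (\<delta> n [^] s)"
  then obtain P Q where PQ: "P \<in> SQP n" "Q \<in> SQP n" "\<delta> n [^] s = P \<otimes> \<beta> \<otimes> Q"
    by (auto simp: braid_le_def G_def)
  obtain P' where P': "P' \<in> SQP n" "P \<otimes> \<delta> n [^] s = \<delta> n [^] s \<otimes> P'"
    using SQP_delta_pow_commute PQ(1) assms(1) by blast
  \<comment> \<open>Multiplying the factorization of \<open>\<delta> n [^] s\<close> by
    \<open>P'\<close> on the right makes both sides start with \<open>P\<close>, which then
    cancels.\<close>
  have "P \<otimes> \<delta> n [^] s = P \<otimes> \<beta> \<otimes> Q \<otimes> P'"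
    unfolding P'(2) by (subst PQ(3)) (rule refl)
  also have "\<dots> = P \<otimes> (\<beta> \<otimes> Q \<otimes> P')"
    using PQ(1,2) P'(1) assms(2) by (simp add: m_assoc)
  finally have "P \<otimes> \<delta> n [^] s = P \<otimes> (\<beta> \<otimes> Q \<otimes> P')" .
  then have "\<delta> n [^] s = \<beta> \<otimes> (Q \<otimes> P')"
    using PQ(1,2) P'(1) assms by (simp add: m_assoc)
  then show "\<exists>Q\<in>SQP n. \<delta> n [^] s = \<beta> \<otimes> Q"
    using PQ(2) P'(1) by (intro bexI[of _ "Q \<otimes> P'"]) simp_all
next
  assume "\<exists>Q\<in>SQP n. \<delta> n [^] s = \<beta> \<otimes> Q"
  then obtain Q where Q: "Q \<in> SQP n" "\<delta> n [^] s = \<beta> \<otimes> Q"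
    by blast
  then have "\<delta> n [^] s = \<one> \<otimes> \<beta> \<otimes> Q"
    using assms(2) by simp
  with Q(1) show "braid_le n \<beta> (\<delta> n [^] s)"
    unfolding braid_le_def G_def[symmetric] by (intro bexI[of _ \<one>] bexI[of _ Q] SQP_one)
qed

section \<open>Completing positive braids to powers of \<open>\<delta>\<close>\<close>

lemma band_dvd_delta:
  assumes "is_band i j"
  obtains Q where "Q \<in> SQP n" "band n i j \<otimes> Q = \<delta> n" "writhe n Q = int n - 2"
proof -
  let ?a = "band n i j"
  \<comment> \<open>Cutting \<open>\<delta>\<close> at \<open>j\<close> and at \<open>i\<close>
    exposes the band behind the positive factor \<open>X\<close>.\<close>
  define X Y where "X = desc j n" and "Y = desc (Suc i) j \<otimes> desc 1 i"
  have S: "X \<in> SQP n" "Y \<in> SQP n"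
    using assms desc_SQP[of j n] desc_SQP[of "Suc i" j] desc_SQP[of 1 i]
    by (auto simp: X_def Y_def)
  have "\<delta> n = X \<otimes> (desc i j \<otimes> desc 1 i)"
    using assms desc_split[of 1 j n] desc_split[of 1 i j] by (simp add: X_def \<delta>_def)
  also have "desc i j \<otimes> desc 1 i = ?a \<otimes> Y"
    using assms by (simp add: Y_def flip: band_desc m_assoc)
  finally have d: "\<delta> n = X \<otimes> (?a \<otimes> Y)" .
  obtain X' where X': "X' \<in> SQP n" "X \<otimes> \<delta> n = \<delta> n \<otimes> X'"
    using SQP_delta_commute[of X] S assms by auto
  \<comment> \<open>Rotation turns \<open>X\<close> into a factor \<open>X'\<close> at the right
    end, and the \<open>X\<close> in front cancels. The complement of the band has writhe
    \<open>int n - 2\<close>, the number of negative bands that remain when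
    \<open>inv (\<delta> n)\<close> absorbs a band.\<close>
  have "X \<otimes> \<delta> n = X \<otimes> (?a \<otimes> Y \<otimes> X')"
    unfolding X'(2) by (subst d) (use S X' assms in \<open>simp add: m_assoc\<close>)
  then have eq: "?a \<otimes> (Y \<otimes> X') = \<delta> n"
    using S X' assms by (simp add: m_assoc)
  moreover have "writhe n (Y \<otimes> X') = int n - 2"
    using arg_cong[OF eq, of "writhe n"] S X' assms by (simp add: writhe_mult delta_SQP)
  ultimately show thesis
    using that[of "Y \<otimes> X'"] S X' by simp
qed

text \<open>Each band is completed to one \<open>\<delta>\<close>, and its complement is moved to
  the right through the power already formed; the writhe of \<open>P\<close> counts its
  bands.\<close>

lemma SQP_dvd_delta_pow:
  assumes "P \<in> SQP n" "1 \<le> n"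
  shows "\<exists>Q\<in>SQP n. P \<otimes> Q = \<delta> n [^] writhe n P"
  using assms(1)
proof (induction rule: SQP_induct)
  case one
  then show ?case by (intro bexI[of _ \<one>]) auto
next
  case (band i j P)
  obtain Q where Q: "Q \<in> SQP n" "P \<otimes> Q = \<delta> n [^] writhe n P"
    using band by blast
  obtain R where R: "R \<in> SQP n" "band n i j \<otimes> R = \<delta> n"
    using band_dvd_delta band by blast
  obtain R' where R': "R' \<in> SQP n" "R \<otimes> \<delta> n [^] writhe n P = \<delta> n [^] writhe n P \<otimes> R'"
    using SQP_delta_pow_commute R(1) assms(2) by blast
  have "(band n i j \<otimes> P) \<otimes> (Q \<otimes> R') = band n i j \<otimes> (P \<otimes> Q) \<otimes> R'"
    using band.hyps Q(1) R(1) R'(1) by (simp add: m_assoc)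
  also have "\<dots> = band n i j \<otimes> (R \<otimes> \<delta> n [^] writhe n P)"
    unfolding Q(2) R'(2) using band R' assms by (simp add: m_assoc)
  also have "\<dots> = \<delta> n \<otimes> \<delta> n [^] writhe n P"
    using band R assms by (simp flip: m_assoc)
  also have "\<dots> = \<delta> n [^] writhe n (band n i j \<otimes> P)"
    using band assms int_pow_mult[of "\<delta> n" 1 "writhe n P"]
    by (simp add: writhe_mult int_pow_1)
  finally show ?case
    using Q R' by (intro bexI[of _ "Q \<otimes> R'"]) auto
qed

text \<open>A negative band is a positive braid times \<open>inv (\<delta> n)\<close>. Moving these
  inverses to the front rotates the positive factors but keeps them positive.\<close>

lemma braid_of_delta_pow:
  assumes "W \<in> band_words n" "1 \<le> n"
  shows "\<exists>P\<in>SQP n. braid_of n W = \<delta> n [^] (- int (word_nb W)) \<otimes> P"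
  using assms(1)
proof (induction W)
  case Nil
  then show ?case by (intro bexI[of _ \<one>]) (auto simp: word_nb_def)
next
  case (Cons x W)
  obtain i j s where x: "x = ((i, j), s)" by (metis surj_pair)
  have ij: "is_band i j" and W: "W \<in> band_words n"
    using Cons.prems by (auto simp: x band_words_Cons)
  let ?k = "- int (word_nb W)" and ?a = "band n i j"
  obtain P where P: "P \<in> SQP n" "braid_of n W = \<delta> n [^] ?k \<otimes> P"
    using Cons.IH W by blast
  show ?case
  proof (cases s)
    case True
    obtain Q where Q: "Q \<in> SQP n" "?a \<otimes> \<delta> n [^] ?k = \<delta> n [^] ?k \<otimes> Q"
      using SQP_delta_pow_commute[OF SQP_band[OF ij] assms(2), of ?k] by blast
    have "braid_of n (x # W) = ?a \<otimes> \<delta> n [^] ?k \<otimes> P"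
      using x True P ij assms by (simp add: braid_of_Cons m_assoc)
    also have "\<dots> = \<delta> n [^] ?k \<otimes> (Q \<otimes> P)"
      unfolding Q(2) using P Q assms by (simp add: m_assoc)
    finally show ?thesis
      using P Q x True by (intro bexI[of _ "Q \<otimes> P"]) (auto simp: word_nb_def)
  next
    case False
    obtain R where R: "R \<in> SQP n" "?a \<otimes> R = \<delta> n"
      using band_dvd_delta ij by blast
    obtain Q where Q: "Q \<in> SQP n" "R \<otimes> \<delta> n [^] (?k - 1) = \<delta> n [^] (?k - 1) \<otimes> Q"
      using SQP_delta_pow_commute[OF R(1) assms(2), of "?k - 1"] by blast
    have inv_a: "inv ?a = R \<otimes> inv (\<delta> n)"
      unfolding R(2)[symmetric] using R(1) ij by (simp add: inv_mult_group flip: m_assoc)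
    have k: "?k - 1 = - 1 + ?k"
      by simp
    have "inv ?a \<otimes> \<delta> n [^] ?k = R \<otimes> (inv (\<delta> n) \<otimes> \<delta> n [^] ?k)"
      unfolding inv_a using R(1) assms(2) by (simp add: m_assoc)
    also have "inv (\<delta> n) \<otimes> \<delta> n [^] ?k = \<delta> n [^] (?k - 1)"
      unfolding k using assms(2) by (simp only: int_pow_mult delta_closed int_pow_neg int_pow_1)
    finally have "inv ?a \<otimes> \<delta> n [^] ?k = R \<otimes> \<delta> n [^] (?k - 1)" .
    then have "inv ?a \<otimes> \<delta> n [^] ?k \<otimes> P = \<delta> n [^] (?k - 1) \<otimes> (Q \<otimes> P)"
      unfolding Q(2) using P(1) Q(1) assms(2) by (simp add: m_assoc)
    moreover have "braid_of n (x # W) = inv ?a \<otimes> \<delta> n [^] ?k \<otimes> P"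
      unfolding braid_of_Cons P(2) using x False P(1) ij assms(2) by (simp add: m_assoc flip: G_def)
    moreover have "- int (word_nb (x # W)) = ?k - 1"
      using x False by (simp add: word_nb_def)
    ultimately show ?thesis
      using P(1) Q(1) by (intro bexI[of _ "Q \<otimes> P"]) simp_all
  qed
qed

text \<open>The innermost \<open>inv (\<delta> n)\<close> absorbs the first band of \<open>P\<close>
  and becomes the inverse of its complement, at a cost of \<open>int n - 2\<close> negative bands.
  The hypothesis on the writhe supplies a band for each of the \<open>r\<close> rounds.\<close>

lemma nb_delta_pow_SQP_le:
  assumes "P \<in> SQP n" "int r \<le> writhe n P" "1 \<le> n"
  shows "int (nb n (\<delta> n [^] (- int r) \<otimes> P)) \<le> int r * (int n - 2)"
  using assms(1,2)
proof (induction r arbitrary: P)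
  case 0
  then show ?case by (simp add: nb_SQP)
next
  case (Suc r)
  obtain i j P' where P: "is_band i j" "P' \<in> SQP n" "P = band n i j \<otimes> P'"
    using SQP_unfold[of P] Suc.prems by auto
  obtain R where R: "R \<in> SQP n" "band n i j \<otimes> R = \<delta> n" "writhe n R = int n - 2"
    using band_dvd_delta P by blast
  let ?d = "\<delta> n [^] (- int r)"
  obtain Q where Q: "Q \<in> SQP n" "?d \<otimes> R = Q \<otimes> ?d" "writhe n Q = writhe n R"
    using delta_pow_SQP_commute[of R] R assms by blast
  have "inv (\<delta> n) \<otimes> band n i j = inv R"
    unfolding R(2)[symmetric] using R(1) P(1) by (simp add: inv_mult_group m_assoc)
  moreover have "- int (Suc r) = - int r + - 1"
    by simp
  then have "\<delta> n [^] (- int (Suc r)) = ?d \<otimes> inv (\<delta> n)"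
    using assms by (simp only: int_pow_mult delta_closed int_pow_neg int_pow_1)
  ultimately have "\<delta> n [^] (- int (Suc r)) \<otimes> P = ?d \<otimes> inv R \<otimes> P'"
    unfolding P(3) using P(1,2) R(1) assms by (metis SQP_band SQP_closed delta_closed int_pow_closed inv_closed m_assoc m_closed)
  \<comment> \<open>Moving the inverse complement out to the left only rotates it, so
    \<open>Q\<close> has the writhe of \<open>R\<close> and the cost is unchanged.\<close>
  also have "?d \<otimes> inv R = inv Q \<otimes> ?d"
    using R(1) Q(1,2) assms by (intro commute_inv) auto
  finally have eq: "\<delta> n [^] (- int (Suc r)) \<otimes> P = inv Q \<otimes> (?d \<otimes> P')"
    using P(2) Q(1) assms by (simp add: m_assoc)
  have "nb n (inv Q \<otimes> (?d \<otimes> P')) \<le> nb n (inv Q) + nb n (?d \<otimes> P')"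
    using P Q assms by (intro nb_mult_le) auto
  moreover have "int (nb n (inv Q)) \<le> int n - 2"
    using nb_inv_SQP[OF Q(1)] Q R by simp
  moreover have "int (nb n (?d \<otimes> P')) \<le> int r * (int n - 2)"
    using Suc.prems P by (intro Suc.IH) (auto simp: writhe_mult)
  ultimately show ?case
    unfolding eq by (simp add: algebra_simps)
qed

lemma SQP_delta_nat_pow: "1 \<le> n \<Longrightarrow> \<delta> n [^] (k :: nat) \<in> SQP n"
  by (induction k) (auto simp: delta_SQP)

section \<open>Infimum, supremum and negative band number of a fixed braid\<close>

context
  fixes \<beta> assumes \<beta>: "\<beta> \<in> carrier G" and n: "2 \<le> n"
begin

lemma n_pos: "1 \<le> n"
  using n by simp

lemma delta_pow_le_ex: "\<exists>r. braid_le n (\<delta> n [^] (r :: int)) \<beta>"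
proof -
  obtain W where "W \<in> band_words n" "braid_of n W = \<beta>"
    using \<beta> by (rule braid_wordE)
  then show ?thesis
    using braid_of_delta_pow[of W] n \<beta> by (auto simp: delta_pow_le_iff)
qed

lemma le_delta_pow_ex: "\<exists>s. braid_le n \<beta> (\<delta> n [^] (s :: int))"
proof -
  obtain r P where P: "P \<in> SQP n" "\<beta> = \<delta> n [^] (r :: int) \<otimes> P"
    using delta_pow_le_ex n \<beta> by (auto simp: delta_pow_le_iff)
  obtain Q where Q: "Q \<in> SQP n" "P \<otimes> Q = \<delta> n [^] writhe n P"
    using SQP_dvd_delta_pow[OF P(1)] n by auto
  have "\<beta> \<otimes> Q = \<delta> n [^] r \<otimes> (P \<otimes> Q)"
    unfolding P(2) using P(1) Q(1) n by (simp add: m_assoc)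
  also have "\<dots> = \<delta> n [^] (r + writhe n P)"
    unfolding Q(2) using n by (simp add: int_pow_mult)
  finally show ?thesis
    using Q(1) le_delta_pow_iff[OF n_pos \<beta>] by metis
qed

text \<open>The positive cofactor has non-negative writhe, so \<open>r * (int n - 1)\<close> is at
  most the writhe of \<open>\<beta>\<close>. As \<open>int n - 1\<close> is at least 1, this bounds
  a non-negative \<open>r\<close>; a negative one lies below the absolute value anyway.\<close>

lemma delta_pow_le_bounded:
  assumes "braid_le n (\<delta> n [^] (r :: int)) \<beta>"
  shows "r \<le> \<bar>writhe n \<beta>\<bar>"
proof -
  obtain P where P: "P \<in> SQP n" "\<beta> = \<delta> n [^] r \<otimes> P"
    using assms n \<beta> by (auto simp: delta_pow_le_iff)
  have "writhe n \<beta> = r * (int n - 1) + writhe n P"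
    unfolding P(2) using P(1) n by (simp add: writhe_mult writhe_delta_pow)
  then have "r * (int n - 1) \<le> writhe n \<beta>"
    using SQP_writhe_nonneg[OF P(1)] by simp
  moreover have "r \<le> r * (int n - 1)" if "0 \<le> r"
    using mult_left_mono[of 1 "int n - 1" r] that n by simp
  ultimately show ?thesis by linarith
qed

lemma le_delta_pow_bounded:
  assumes "braid_le n \<beta> (\<delta> n [^] (s :: int))"
  shows "- \<bar>writhe n \<beta>\<bar> \<le> s"
proof -
  obtain Q where Q: "Q \<in> SQP n" "\<delta> n [^] s = \<beta> \<otimes> Q"
    using assms n \<beta> by (auto simp: le_delta_pow_iff)
  have "s * (int n - 1) = writhe n \<beta> + writhe n Q"
    using arg_cong[OF Q(2), of "writhe n"] Q(1) n \<beta> by (simp add: writhe_mult writhe_delta_pow)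
  then have "writhe n \<beta> \<le> s * (int n - 1)"
    using SQP_writhe_nonneg[OF Q(1)] by simp
  moreover have "s * (int n - 1) \<le> s" if "s \<le> 0"
    using mult_left_mono_neg[of 1 "int n - 1" s] that n by simp
  ultimately show ?thesis by linarith
qed

lemma braid_inf:
  shows "braid_le n (\<delta> n [^] braid_inf n \<beta>) \<beta>"
    and "braid_le n (\<delta> n [^] (r :: int)) \<beta> \<Longrightarrow> r \<le> braid_inf n \<beta>"
  unfolding braid_inf_def G_def[symmetric]
  by (rule int_Greatest[OF delta_pow_le_ex delta_pow_le_bounded], assumption)+

lemma braid_sup:
  shows "braid_le n \<beta> (\<delta> n [^] braid_sup n \<beta>)"
    and "braid_le n \<beta> (\<delta> n [^] (s :: int)) \<Longrightarrow> braid_sup n \<beta> \<le> s"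
  unfolding braid_sup_def G_def[symmetric]
  by (rule int_Least[OF le_delta_pow_ex le_delta_pow_bounded], assumption)+

lemma braid_infE:
  obtains P where "P \<in> SQP n" "\<beta> = \<delta> n [^] braid_inf n \<beta> \<otimes> P"
  using braid_inf(1) unfolding delta_pow_le_iff[OF n_pos \<beta>] by (elim bexE) (rule that)

lemma braid_supE:
  obtains Q where "Q \<in> SQP n" "\<delta> n [^] braid_sup n \<beta> = \<beta> \<otimes> Q"
  using braid_sup(1) unfolding le_delta_pow_iff[OF n_pos \<beta>] by (elim bexE) (rule that)

lemma braid_inf_ge:
  assumes "P \<in> SQP n" "\<beta> = \<delta> n [^] (r :: int) \<otimes> P"
  shows "r \<le> braid_inf n \<beta>"
  using assms by (intro braid_inf(2) iffD2[OF delta_pow_le_iff[OF n_pos \<beta>]] bexI[of _ P])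

text \<open>\<open>P\<close> completes to a power of \<open>\<delta>\<close> with one factor per
  band. The bound is used both ways: it provides enough bands for absorption, and it bounds the
  writhe of \<open>\<beta>\<close> from below.\<close>

lemma braid_sup_le:
  assumes "P \<in> SQP n" "\<beta> = \<delta> n [^] (r :: int) \<otimes> P"
  shows "braid_sup n \<beta> \<le> r + writhe n P"
proof -
  obtain Q where Q: "Q \<in> SQP n" "P \<otimes> Q = \<delta> n [^] writhe n P"
    using SQP_dvd_delta_pow[OF assms(1)] n by auto
  have "\<beta> \<otimes> Q = \<delta> n [^] r \<otimes> (P \<otimes> Q)"
    unfolding assms(2) using assms(1) Q(1) n by (simp add: m_assoc)
  also have "\<dots> = \<delta> n [^] (r + writhe n P)"
    unfolding Q(2) using n by (simp add: int_pow_mult)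
  finally have "braid_le n \<beta> (\<delta> n [^] (r + writhe n P))"
    using Q(1) le_delta_pow_iff[OF n_pos \<beta>] by metis
  then show ?thesis by (rule braid_sup(2))
qed

text \<open>Collecting the inverses of \<open>\<delta>\<close> in a word with fewest negative bands
  shows that \<open>- int (nb n \<beta>)\<close> is an admissible exponent for the infimum.\<close>

lemma nb_ge_neg_inf: "- braid_inf n \<beta> \<le> int (nb n \<beta>)"
proof -
  obtain W where W: "W \<in> band_words n" "braid_of n W = \<beta>" "word_nb W = nb n \<beta>"
    using \<beta> by (rule nb_wordE)
  obtain P where P: "P \<in> SQP n" "\<beta> = \<delta> n [^] (- int (nb n \<beta>)) \<otimes> P"
    using braid_of_delta_pow[OF W(1) n_pos] unfolding W(2,3) by (elim bexE)
  show ?thesis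
    using braid_inf_ge[OF P] by simp
qed

lemma nb_le_of_inf_neg:
  assumes "braid_inf n \<beta> < 0" "0 < braid_sup n \<beta>"
  shows "int (nb n \<beta>) \<le> (int n - 2) * \<bar>braid_inf n \<beta>\<bar>"
proof -
  obtain P where P: "P \<in> SQP n" "\<beta> = \<delta> n [^] braid_inf n \<beta> \<otimes> P"
    by (rule braid_infE)
  define r where "r = nat (- braid_inf n \<beta>)"
  have r: "braid_inf n \<beta> = - int r"
    using assms by (simp add: r_def)
  \<comment> \<open>A positive supremum is at most \<open>writhe n P - int r\<close>, so
    \<open>P\<close> has enough bands for all \<open>r\<close> inverses.\<close>
  have "int r \<le> writhe n P"
    using braid_sup_le[OF P] assms r by simp
  then have "int (nb n (\<delta> n [^] (- int r) \<otimes> P)) \<le> int r * (int n - 2)"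
    using n P(1) by (intro nb_delta_pow_SQP_le) auto
  moreover have "\<delta> n [^] (- int r) \<otimes> P = \<beta>"
    using P(2) unfolding r by (rule sym)
  ultimately show ?thesis
    by (simp add: r mult.commute)
qed

lemma writhe_braid_inf:
  assumes "P \<in> SQP n" "\<beta> = \<delta> n [^] (r :: int) \<otimes> P"
  shows "writhe n \<beta> = r * (int n - 1) + writhe n P"
  unfolding assms(2) using assms(1) n by (simp add: writhe_mult writhe_delta_pow)

text \<open>Since \<open>\<beta>\<close> times a positive braid is a non-positive power of
  \<open>\<delta>\<close>, the inverse of \<open>\<beta>\<close> is positive; counting its bands
  bounds \<open>nb\<close> from above.\<close>

lemma nb_eq_of_sup_nonpos:
  assumes "braid_sup n \<beta> \<le> 0"
  shows "int (nb n \<beta>) = - writhe n \<beta>"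
proof (rule antisym)
  obtain Q where Q: "Q \<in> SQP n" "\<delta> n [^] braid_sup n \<beta> = \<beta> \<otimes> Q"
    by (rule braid_supE)
  define s where "s = nat (- braid_sup n \<beta>)"
  have s: "braid_sup n \<beta> = - int s"
    using assms by (simp add: s_def)
  have "\<beta> \<otimes> (Q \<otimes> \<delta> n [^] s) = \<delta> n [^] braid_sup n \<beta> \<otimes> \<delta> n [^] s"
    unfolding Q(2) using Q(1) n \<beta> by (simp add: m_assoc)
  also have "\<dots> = \<one>"
    unfolding s using n by (simp add: int_pow_neg_int)
  finally have "Q \<otimes> \<delta> n [^] s \<otimes> \<beta> = \<one>"
    by (rule inv_comm) (use Q(1) n \<beta> in simp_all)
  then have "inv \<beta> = Q \<otimes> \<delta> n [^] s"
    by (rule inv_equality) (use Q(1) n \<beta> in simp_all)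
  then have "inv \<beta> \<in> SQP n"
    using Q(1) n SQP_delta_nat_pow by simp
  from nb_inv_SQP[OF this] show "int (nb n \<beta>) \<le> - writhe n \<beta>"
    using \<beta> by (simp add: writhe_inv)
qed (use \<beta> in \<open>simp add: neg_writhe_le_nb\<close>)

lemma neg_writhe_le:
  assumes "braid_inf n \<beta> < 0"
  shows "- writhe n \<beta> \<le> (int n - 2) * \<bar>braid_inf n \<beta>\<bar> - braid_sup n \<beta>"
proof -
  obtain P where P: "P \<in> SQP n" "\<beta> = \<delta> n [^] braid_inf n \<beta> \<otimes> P"
    by (rule braid_infE)
  show ?thesis
    using writhe_braid_inf[OF P] braid_sup_le[OF P] assms by (simp add: algebra_simps)
qed

end

end

section \<open>Dual normal forms on three strands\<close>

datatype atom = A12 | A13 | A23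

text \<open>Conjugation by \<open>\<delta>\<close>, which permutes the three bands cyclically:
  \<open>\<delta> x = next_atom x \<delta>\<close>.\<close>

fun next_atom :: "atom \<Rightarrow> atom" where
  "next_atom A23 = A12"
| "next_atom A12 = A13"
| "next_atom A13 = A23"

lemma next_atom_inj [simp]: "next_atom x = next_atom y \<longleftrightarrow> x = y"
  by (cases x; cases y) simp_all

lemma next_atom_3 [simp]: "next_atom (next_atom (next_atom x)) = x"
  by (cases x) simp_all

text \<open>The pair \<open>(w, k)\<close> encodes the braid \<open>w \<delta>\<^sup>k\<close>. Since \<open>\<delta> = x y\<close> exactly for
  \<open>y = next_atom x\<close>, the following are the words without a factor \<open>\<delta>\<close>.\<close>

abbreviation delta_free :: "atom list \<Rightarrow> bool" where
  "delta_free \<equiv> successively (\<lambda>x y. y \<noteq> next_atom x)"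

text \<open>Left multiplication by a band. If the band and the head form \<open>\<delta>\<close>,
  this factor moves to the right end and rotates the remaining letters.\<close>

fun act :: "atom \<Rightarrow> atom list \<times> int \<Rightarrow> atom list \<times> int" where
  "act x ([], k) = ([x], k)"
| "act x (y # w, k) = (if y = next_atom x then (map next_atom w, k + 1) else (x # y # w, k))"

fun act_delta :: "atom list \<times> int \<Rightarrow> atom list \<times> int" where
  "act_delta (w, k) = (map next_atom w, k + 1)"

text \<open>\<open>next_atom\<close> has order three, so applying it twice undoes the
  rotation.\<close>

fun act_delta_inv :: "atom list \<times> int \<Rightarrow> atom list \<times> int" where
  "act_delta_inv (w, k) = (map (next_atom \<circ> next_atom) w, k - 1)"

lemma delta_free_map [simp]: "delta_free (map next_atom w) \<longleftrightarrow> delta_free w"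
  by (simp add: successively_map)

lemma delta_free_act: "delta_free (fst s) \<Longrightarrow> delta_free (fst (act x s))"
  by (cases "(x, s)" rule: act.cases) (auto simp: successively_Cons)

lemma delta_free_act_delta_inv: "delta_free (fst s) \<Longrightarrow> delta_free (fst (act_delta_inv s))"
  by (cases s) (simp flip: map_map)

lemma act_delta_inv_act_delta [simp]: "act_delta_inv (act_delta s) = s"
  by (cases s) (simp add: comp_def)

lemma act_delta_act_delta_inv [simp]: "act_delta (act_delta_inv s) = s"
  by (cases s) (simp add: comp_def)

lemma act_delta_act: "act_delta (act x s) = act (next_atom x) (act_delta s)"
  by (cases "(x, s)" rule: act.cases) auto

lemma act_delta_inv_act: "act_delta_inv (act (next_atom x) s) = act x (act_delta_inv s)"
  by (metis act_delta_act act_delta_act_delta_inv act_delta_inv_act_delta)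

lemma act_act:
  assumes "delta_free (fst s)"
  shows "act x (act (next_atom x) s) = act_delta s"
proof (cases s)
  case (Pair w k)
  show ?thesis
  proof (cases w)
    case Nil
    then show ?thesis using Pair by simp
  next
    case (Cons y v)
    show ?thesis
    proof (cases "y = next_atom (next_atom x)")
      \<comment> \<open>Here \<open>next_atom x\<close> absorbs \<open>y\<close>. As
        \<open>w\<close> has no factor \<open>\<delta>\<close>, the rotated next letter cannot
        absorb \<open>x\<close>, so \<open>x\<close> is prepended; it equals the rotated
        \<open>y\<close>.\<close>
      case True
      then show ?thesis
        using Pair Cons assms by (cases v) auto
    next
      case False
      then show ?thesis using Pair Cons by simp
    qed
  qed
qed

text \<open>With \<open>y = next_atom (next_atom x)\<close> one has \<open>\<delta> = y x\<close>,
  hence the inverse of \<open>x\<close> is that of \<open>\<delta>\<close> times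
  \<open>y\<close>.\<close>

definition act_inv :: "atom \<Rightarrow> atom list \<times> int \<Rightarrow> atom list \<times> int" where
  "act_inv x s = act_delta_inv (act (next_atom (next_atom x)) s)"

lemma act_inv_act:
  assumes "delta_free (fst s)"
  shows "act_inv x (act x s) = s"
  using act_act[OF assms, of "next_atom (next_atom x)"] by (simp add: act_inv_def)

lemma act_act_inv:
  assumes "delta_free (fst s)"
  shows "act x (act_inv x s) = s"
  using act_act[OF assms, of "next_atom x"]
  by (simp add: act_inv_def flip: act_delta_inv_act)

lemma delta_free_act_inv: "delta_free (fst s) \<Longrightarrow> delta_free (fst (act_inv x s))"
  by (simp add: act_inv_def delta_free_act delta_free_act_delta_inv)

text \<open>On three strands the only indices are 1 and 2, so every index other than 1 is read as
  2.\<close>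

fun act_letter :: "nat \<times> bool \<Rightarrow> atom list \<times> int \<Rightarrow> atom list \<times> int" where
  "act_letter (i, s) = (if s then act else act_inv) (if i = 1 then A12 else A23)"

abbreviation act_word :: "artin_word \<Rightarrow> atom list \<times> int \<Rightarrow> atom list \<times> int" where
  "act_word \<equiv> foldr act_letter"

lemma delta_free_act_word: "delta_free (fst s) \<Longrightarrow> delta_free (fst (act_word w s))"
  by (induction w) (auto simp: delta_free_act delta_free_act_inv)

text \<open>Artin's relations hold for the action, so its result depends on the braid alone. Far
  commutation does not occur on three strands, and both sides of the braid relation act as
  \<open>\<delta>\<close> after \<open>A23\<close>.\<close>

lemma act_word_cong:
  "artin_eq 3 u v \<Longrightarrow> delta_free (fst s) \<Longrightarrow> act_word u s = act_word v s"
proof (induction arbitrary: s rule: artin_eq.induct)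
  case (artin_append u u' v v')
  then show ?case by (simp add: delta_free_act_word)
next
  case (artin_cancel i b)
  then show ?case by (cases b) (auto simp: act_inv_act act_act_inv)
next
  case (artin_braid i)
  then have i: "i = 1" by simp
  have "act A12 (act A23 (act A12 s)) = act A12 (act_delta s)"
    using act_act[OF artin_braid(3), of A23] by simp
  also have "\<dots> = act_delta (act A23 s)"
    by (simp add: act_delta_act)
  also have "\<dots> = act A23 (act A12 (act A23 s))"
    using act_act[of "act A23 s" A23] artin_braid(3) by (simp add: delta_free_act)
  finally show ?case by (simp add: i)
qed simp_all

fun atom_word :: "atom \<Rightarrow> artin_word" where
  "atom_word A12 = [(1, True)]"
| "atom_word A23 = [(2, True)]"
| "atom_word A13 = [(2, True), (1, True), (2, False)]"

text \<open>Only \<open>A13\<close> needs an argument: \<open>\<sigma>\<close> with index 2 followed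
  by index 1 acts as \<open>\<delta>\<close>, while the inverse letter acts as \<open>A13\<close>
  followed by the inverse of \<open>\<delta>\<close>.\<close>

lemma act_atom_word:
  assumes "delta_free (fst s)"
  shows "act_word (atom_word x) s = act x s"
proof (cases x)
  case A13
  have "act A23 (act A12 (act_inv A23 s)) = act_delta (act_inv A23 s)"
    using act_act[of "act_inv A23 s" A23] assms by (simp add: delta_free_act_inv)
  then show ?thesis
    using A13 by (simp add: act_inv_def)
qed simp_all

lemma act_concat_atom_word:
  "delta_free (fst s) \<Longrightarrow> act_word (concat (map atom_word w)) s = foldr act w s
    \<and> delta_free (fst (foldr act w s))"
  by (induction w) (simp_all add: act_atom_word delta_free_act)

text \<open>No letter meets a head that it could absorb, so the word is rebuilt unchanged.\<close>

lemma foldr_act_delta_free: "delta_free w \<Longrightarrow> foldr act w ([], k) = (w, k)"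
proof (induction w)
  case (Cons x w)
  then show ?case by (cases w) (auto simp: successively_Cons)
qed simp

text \<open>For a word without a factor \<open>\<delta>\<close>, this is the supremum of the encoded
  braid.\<close>

definition height :: "atom list \<times> int \<Rightarrow> int" where
  "height s = int (length (fst s)) + snd s"

text \<open>Absorbing the head trades one letter for one power of \<open>\<delta>\<close>;
  prepending a letter adds one.\<close>

lemma height_act: "height s \<le> height (act x s)"
  by (cases "(x, s)" rule: act.cases) (auto simp: height_def)

lemma height_foldr_act: "height s \<le> height (foldr act w s)"
  by (induction w) (auto intro: order_trans height_act)

lemma not_delta_free_split:
  "\<not> delta_free w \<Longrightarrow> \<exists>u x v. w = u @ x # next_atom x # v"
proof (induction w)
  case (Cons x w)
  show ?case
  proof (cases "delta_free w")
    case True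
    then show ?thesis using Cons.prems
      by (cases w) (auto intro!: exI[of _ "[]"])
  next
    case False
    then obtain u y v where "w = u @ y # next_atom y # v"
      using Cons.IH by blast
    then show ?thesis by (intro exI[of _ "x # u"]) auto
  qed
qed simp

section \<open>Positive braids on three strands as words in the atoms\<close>

fun atom_pair :: "atom \<Rightarrow> nat \<times> nat" where
  "atom_pair A12 = (1, 2)"
| "atom_pair A13 = (1, 3)"
| "atom_pair A23 = (2, 3)"

definition atom_band_word :: "atom list \<Rightarrow> band_word" where
  "atom_band_word = map (\<lambda>x. (atom_pair x, True))"

lemma atom_band_word_words [simp]: "atom_band_word w \<in> band_words 3"
proof -
  have "1 \<le> i \<and> i < j \<and> j \<le> 3" if "(i, j) = atom_pair x" for i j x
    using that by (cases x) auto
  then show ?thesis by (auto simp: atom_band_word_def band_words_def)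
qed

lemma SQP_3_atom_word:
  assumes "P \<in> SQP 3"
  obtains w where "P = braid_of 3 (atom_band_word w)"
proof -
  obtain W where W: "W \<in> band_words 3" "\<forall>x\<in>set W. snd x" "P = braid_of 3 W"
    using assms by (auto simp: SQP_def)
  from W(1,2) have "\<exists>w. W = atom_band_word w"
  proof (induction W)
    case Nil
    then show ?case by (simp add: atom_band_word_def)
  next
    case (Cons x W)
    obtain i j where x: "x = ((i, j), True)" and ij: "1 \<le> i" "i < j" "j \<le> 3"
      using Cons.prems by (cases x) (auto simp: band_words_def)
    have "(i, j) \<in> {(1, 2), (1, 3), (2, 3)}"
      using ij by auto
    then obtain a where "(i, j) = atom_pair a"
      by (metis atom_pair.simps insertE singletonD)
    moreover obtain w where "W = atom_band_word w"
      using Cons by (auto simp: band_words_def)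
    ultimately have "x # W = atom_band_word (a # w)"
      by (simp add: x atom_band_word_def)
    then show ?case by blast
  qed
  with W(3) that show thesis by blast
qed

lemma atom_word_words [simp]: "atom_word x \<in> artin_words 3"
  by (cases x) (auto simp: artin_words_def)

lemma signed_band_atom: "signed_band 3 (atom_pair x, True) = braid_class 3 (atom_word x)"
proof (cases x)
  case A13
  have w: "[(1, True)] \<in> artin_words 3" "[(2, True)] \<in> artin_words 3" "[(2, False)] \<in> artin_words 3"
    by (auto simp: artin_words_def)
  have "descending_prod 3 2 3 = braid_class 3 [(2, True)]"
    using w by (simp add: descending_prod_def braid_prod_Cons braid_prod_Nil artin_gen_def upt_rec)
  moreover have "inverse_word [(2, True)] = [(2, False)]"
    by (simp add: inverse_word_def)
  ultimately show ?thesis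
    using A13 w by (simp add: band_def artin_gen_def inv_braid_class flip: numeral_2_eq_2)
      (simp add: artin_words_def)
qed (use signed_band_artin[of 1 3 True] signed_band_artin[of 2 3 True] in
    \<open>simp_all add: numeral_2_eq_2 numeral_3_eq_3\<close>)

lemma braid_of_atom_word:
  "concat (map atom_word w) \<in> artin_words 3 \<and>
    braid_of 3 (atom_band_word w) = braid_class 3 (concat (map atom_word w))"
proof (induction w)
  case Nil
  then show ?case by (simp add: atom_band_word_def braid_of_def braid_prod_Nil)
next
  case (Cons x w)
  then show ?case
    by (simp add: atom_band_word_def braid_of_def braid_prod_Cons signed_band_atom
        del: signed_band.simps)
qed

section \<open>Sharpness of the bounds on three strands\<close>

context braid_monoid
begin

context
  assumes n: "n = 3"
begin

abbreviation atom :: "atom \<Rightarrow> artin_word set" where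
  "atom x \<equiv> signed_band n (atom_pair x, True)"

lemma atom_closed [simp]: "atom x \<in> carrier G"
  using n band_closed[of 1 2] band_closed[of 1 3] band_closed[of 2 3] by (cases x) simp_all

lemma braid_of_atom_Cons: "braid_of n (atom_band_word (x # w)) = atom x \<otimes> braid_of n (atom_band_word w)"
  by (simp add: atom_band_word_def braid_of_Cons)

lemma atom_band_word_append: "atom_band_word (u @ v) = atom_band_word u @ atom_band_word v"
  by (simp add: atom_band_word_def)

lemma delta_3: "\<delta> 3 = braid_class 3 (atom_word A23 @ atom_word A12)"
proof -
  have "[(1, True)] \<in> artin_words 3" "[(2, True)] \<in> artin_words 3"
    by (auto simp: artin_words_def)
  then show ?thesis
    by (simp add: \<delta>_def descending_prod_def braid_prod_Cons braid_prod_Nil artin_gen_def upt_rec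
        numeral_2_eq_2)
qed

lemma delta_atom: "\<delta> n \<otimes> atom x = atom (next_atom x) \<otimes> \<delta> n"
  using delta_band_Suc[of 1 2] delta_band_1[of 1] delta_band_1[of 2] n
  by (cases x) (simp_all add: numeral_2_eq_2 numeral_3_eq_3)

text \<open>The defining factorization of \<open>\<delta>\<close> is the case \<open>A23\<close>;
  conjugation by \<open>\<delta>\<close> rotates it into the other two.\<close>

lemma atom_next_atom: "atom x \<otimes> atom (next_atom x) = \<delta> n"
proof -
  have base: "atom A23 \<otimes> atom A12 = \<delta> n"
    unfolding n delta_3 signed_band_atom G_def
    by (rule mult_braid_class[OF atom_word_words atom_word_words])
  have step: "atom (next_atom x) \<otimes> atom (next_atom (next_atom x)) = \<delta> n"
    if "atom x \<otimes> atom (next_atom x) = \<delta> n" for x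
  proof -
    have d: "\<delta> n \<in> carrier G"
      by (rule delta_closed) (simp add: n)
    have "atom (next_atom x) \<otimes> atom (next_atom (next_atom x)) \<otimes> \<delta> n =
        atom (next_atom x) \<otimes> (\<delta> n \<otimes> atom (next_atom x))"
      unfolding delta_atom using d by (simp add: m_assoc del: signed_band.simps)
    also have "\<dots> = \<delta> n \<otimes> (atom x \<otimes> atom (next_atom x))"
      using d by (simp add: delta_atom[of x] del: signed_band.simps flip: m_assoc)
    finally show ?thesis
      unfolding that using d by (simp del: signed_band.simps)
  qed
  show ?thesis
    using base step[of A23] step[of A12] by (cases x) (simp_all del: signed_band.simps)
qed

text \<open>Two adjacent letters multiply to \<open>\<delta>\<close>, which moves to the front past
  a positive prefix.\<close>

lemma delta_dvd_not_delta_free: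
  assumes "\<not> delta_free w"
  shows "\<exists>P\<in>SQP n. braid_of n (atom_band_word w) = \<delta> n \<otimes> P"
proof -
  obtain u x v where w: "w = u @ x # next_atom x # v"
    using not_delta_free_split[OF assms] by blast
  have words: "atom_band_word z \<in> band_words n" for z
    by (simp add: n)
  have S: "braid_of n (atom_band_word z) \<in> SQP n" for z
    using words[of z] unfolding SQP_def
    by (auto intro!: exI[of _ "atom_band_word z"]) (auto simp: atom_band_word_def)
  have d: "\<delta> n \<in> carrier G"
    by (rule delta_closed) (simp add: n)
  let ?U = "braid_of n (atom_band_word u)" and ?V = "braid_of n (atom_band_word v)"
  have "braid_of n (atom_band_word w) = ?U \<otimes> (atom x \<otimes> (atom (next_atom x) \<otimes> ?V))"
    unfolding w atom_band_word_append
    by (simp add: braid_of_append words braid_of_atom_Cons del: signed_band.simps)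
  also have "\<dots> = ?U \<otimes> \<delta> n \<otimes> ?V"
    unfolding atom_next_atom[of x, symmetric] using S[of u] S[of v]
    by (simp add: m_assoc del: signed_band.simps)
  finally have eq: "braid_of n (atom_band_word w) = ?U \<otimes> \<delta> n \<otimes> ?V" .
  obtain U' where U': "U' \<in> SQP n" "?U \<otimes> \<delta> n = \<delta> n \<otimes> U'"
    using SQP_delta_commute[OF S[of u]] n by auto
  have "braid_of n (atom_band_word w) = \<delta> n \<otimes> (U' \<otimes> ?V)"
    unfolding eq U'(2) using U'(1) S[of v] d by (simp add: m_assoc)
  moreover have "U' \<otimes> ?V \<in> SQP n"
    using U'(1) S[of v] by (rule SQP_mult)
  ultimately show ?thesis by (rule bexI)
qed

text \<open>The action is defined on words, so a representative of the power is produced as well.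
  Quantifying over \<open>k\<close> lets the induction continue after the first
  \<open>\<delta>\<close> has acted.\<close>

lemma delta_pow_act:
  "\<exists>w\<in>artin_words 3. \<delta> n [^] (t :: nat) = braid_class 3 w \<and>
    (\<forall>k. act_word w ([], k) = ([], k + int t))"
proof (induction t)
  case 0
  then show ?case by (intro bexI[of _ "[]"]) (simp_all add: G_def n one_braid_group)
next
  case (Suc t)
  then obtain w where w: "w \<in> artin_words 3" "\<delta> n [^] t = braid_class 3 w"
    "\<And>k. act_word w ([], k) = ([], k + int t)"
    by blast
  let ?d = "atom_word A23 @ atom_word A12"
  have d: "?d \<in> artin_words 3"
    by (simp only: append_artin_words atom_word_words)
  have "\<delta> n [^] Suc t = braid_class 3 w \<otimes> braid_class 3 ?d"
    using w(2) delta_3 n by simp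
  also have "\<dots> = braid_class 3 (w @ ?d)"
    unfolding G_def n using w(1) d by (rule mult_braid_class)
  finally show ?case
    using w d by (intro bexI[of _ "w @ ?d"]) auto
qed

text \<open>Acting on the empty normal form, \<open>w\<close> produces a normal form of height \<open>length w\<close>, which
  the positive braid \<open>P\<close> cannot lower.\<close>

lemma length_le_of_delta_free:
  assumes "delta_free w" "P \<in> SQP n"
    and eq: "P \<otimes> braid_of n (atom_band_word w) = \<delta> n [^] (t :: nat)"
  shows "length w \<le> t"
proof -
  obtain u where u: "P = braid_of n (atom_band_word u)"
    using SQP_3_atom_word assms(2) n by metis
  obtain v where v: "v \<in> artin_words 3" "\<delta> n [^] t = braid_class 3 v"
    "act_word v ([], 0) = ([], int t)"
    using delta_pow_act[of t] by auto
  let ?c = "\<lambda>w. concat (map atom_word w)"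
  have c: "braid_of n (atom_band_word z) = braid_class 3 (?c z)" "?c z \<in> artin_words 3" for z
    using braid_of_atom_word[of z] n by simp_all
  have "braid_class 3 v = braid_class 3 (?c u) \<otimes> braid_class 3 (?c w)"
    using eq[symmetric] unfolding u v(2) c(1) .
  also have "\<dots> = braid_class 3 (?c u @ ?c w)"
    unfolding G_def n using c(2) by (intro mult_braid_class)
  finally have "artin_eq 3 (?c u @ ?c w) v"
    using v(1) c(2) by (simp only: braid_class_eq_iff append_artin_words simp_thms artin_sym)
  from act_word_cong[OF this, of "([], 0)"]
  have "foldr act u (w, 0) = ([], int t)"
    using v(3) assms(1) by (simp add: act_concat_atom_word foldr_act_delta_free)
  then show ?thesis
    using height_foldr_act[of "(w, 0)" u] by (simp add: height_def)
qed

lemma writhe_atom_band_word: "writhe n (braid_of n (atom_band_word w)) = int (length w)"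
proof -
  have "filter snd (atom_band_word w) = atom_band_word w" "filter (\<lambda>x. \<not> snd x) (atom_band_word w) = []"
    by (simp_all add: atom_band_word_def filter_empty_conv)
  then show ?thesis
    using writhe_braid_of[of "atom_band_word w" n] n
    by (simp add: word_writhe_def) (simp add: atom_band_word_def)
qed

text \<open>Maximality of the infimum forbids a factor \<open>\<delta>\<close> in a word
  \<open>w\<close> for \<open>P\<close>, so \<open>w\<close> is a normal form. The supremum makes it
  divide a power of \<open>\<delta>\<close> with exponent the difference of the two, which is
  therefore at least the length of \<open>w\<close>.\<close>

lemma writhe_le_sup_inf:
  assumes \<beta>: "\<beta> \<in> carrier G" and P: "P \<in> SQP n" "\<beta> = \<delta> n [^] braid_inf n \<beta> \<otimes> P"
    and "braid_inf n \<beta> \<le> braid_sup n \<beta>"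
  shows "writhe n P \<le> braid_sup n \<beta> - braid_inf n \<beta>"
proof -
  have n2: "2 \<le> n" "1 \<le> n" using n by simp_all
  define i s t where "i = braid_inf n \<beta>" and "s = braid_sup n \<beta>" and "t = nat (s - i)"
  have t: "int t = s - i"
    using assms(4) by (simp add: t_def s_def i_def)
  have \<beta>P: "\<beta> = \<delta> n [^] i \<otimes> P"
    using P(2) unfolding i_def .
  obtain w where w: "P = braid_of n (atom_band_word w)"
    using SQP_3_atom_word P(1) n by metis
  have "delta_free w"
  proof (rule ccontr)
    assume "\<not> delta_free w"
    then obtain P' where P': "P' \<in> SQP n" "P = \<delta> n \<otimes> P'"
      using delta_dvd_not_delta_free w by blast
    have "\<beta> = \<delta> n [^] (i + 1) \<otimes> P'"
      unfolding \<beta>P P'(2) using P'(1) n2 by (simp add: int_pow_mult m_assoc)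
    from braid_inf_ge[OF \<beta> n2(1) P'(1) this] show False
      by (simp add: i_def)
  qed
  obtain Q where Q: "Q \<in> SQP n" "\<delta> n [^] s = \<beta> \<otimes> Q"
    using braid_supE[OF \<beta> n2(1)] unfolding s_def by blast
  have "\<delta> n [^] i \<otimes> (P \<otimes> Q) = \<delta> n [^] s"
    unfolding Q(2) \<beta>P using P(1) Q(1) n2 by (simp add: m_assoc)
  also have "\<dots> = \<delta> n [^] i \<otimes> \<delta> n [^] int t"
    unfolding t using n2 by (simp flip: int_pow_mult)
  finally have PQ: "P \<otimes> Q = \<delta> n [^] int t"
    using P(1) Q(1) n2 by simp
  \<comment> \<open>\<open>length_le_of_delta_free\<close> wants the cofactor on the left. Moving
    \<open>Q\<close> through \<open>\<delta> n [^] int t\<close> gives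
    \<open>Q' P Q = \<delta> n [^] int t \<otimes> Q\<close>, and \<open>Q\<close> cancels.\<close>
  obtain Q' where Q': "Q' \<in> SQP n" "\<delta> n [^] int t \<otimes> Q = Q' \<otimes> \<delta> n [^] int t"
    using delta_pow_SQP_commute[OF Q(1) n2(2)] by blast
  have "Q' \<otimes> P \<otimes> Q = Q' \<otimes> \<delta> n [^] int t"
    unfolding PQ[symmetric] using P(1) Q(1) Q'(1) by (simp add: m_assoc)
  also note Q'(2)[symmetric]
  finally have "Q' \<otimes> P = \<delta> n [^] t"
    using P(1) Q(1) Q'(1) n2 by (simp add: int_pow_int)
  then have "length w \<le> t"
    using length_le_of_delta_free \<open>delta_free w\<close> Q'(1) unfolding w by blast
  then show ?thesis
    using writhe_atom_band_word[of w] t by (simp add: w s_def i_def)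
qed

text \<open>For three strands the factor \<open>int n - 2\<close> is 1, so the upper bound meets the
  lower bound \<open>nb_ge_neg_inf\<close>.\<close>

lemma nb_eq_3:
  assumes "\<beta> \<in> carrier G" "braid_inf n \<beta> < 0" "0 < braid_sup n \<beta>"
  shows "int (nb n \<beta>) = (int n - 2) * \<bar>braid_inf n \<beta>\<bar>"
proof -
  have "2 \<le> n" using n by simp
  from nb_le_of_inf_neg[OF assms(1) this assms(2,3)] nb_ge_neg_inf[OF assms(1) this]
  show ?thesis using assms(2) by (simp add: n)
qed

text \<open>\<open>writhe_le_sup_inf\<close> is the converse of \<open>braid_sup_le\<close>, so the
  writhe of \<open>P\<close> is exactly supremum minus infimum.\<close>

lemma neg_writhe_eq_3:
  assumes \<beta>: "\<beta> \<in> carrier G"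
    and "braid_inf n \<beta> < braid_sup n \<beta>" "braid_sup n \<beta> \<le> 0"
  shows "- writhe n \<beta> = (int n - 2) * \<bar>braid_inf n \<beta>\<bar> + \<bar>braid_sup n \<beta>\<bar>"
proof -
  have n2: "2 \<le> n" using n by simp
  obtain P where P: "P \<in> SQP n" "\<beta> = \<delta> n [^] braid_inf n \<beta> \<otimes> P"
    using \<beta> n2 by (rule braid_infE)
  have "writhe n P = braid_sup n \<beta> - braid_inf n \<beta>"
    using writhe_le_sup_inf[OF \<beta> P] braid_sup_le[OF \<beta> n2 P] assms(2) by simp
  moreover have "writhe n \<beta> = 2 * braid_inf n \<beta> + writhe n P"
    using writhe_braid_inf[OF \<beta> n2 P] n by simp
  ultimately show ?thesis
    using assms(2,3) by (simp add: n)
qed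

end

end

theorem theorem1p6:
  fixes n :: nat and \<beta> :: "artin_word set"
  assumes "n \<ge> 3" and "\<beta> \<in> carrier (braid_group n)"
  shows "(braid_inf n \<beta> < 0 \<and> 0 < braid_sup n \<beta> \<longrightarrow>
            int (nb n \<beta>) \<le> (int n - 2) * \<bar>braid_inf n \<beta>\<bar>) \<and>
         (braid_inf n \<beta> < braid_sup n \<beta> \<and> braid_sup n \<beta> \<le> 0 \<longrightarrow>
            int (nb n \<beta>) = - writhe n \<beta> \<and>
            - writhe n \<beta> \<le> (int n - 2) * \<bar>braid_inf n \<beta>\<bar> + \<bar>braid_sup n \<beta>\<bar>) \<and>
         (n = 3 \<longrightarrow>
            (braid_inf n \<beta> < 0 \<and> 0 < braid_sup n \<beta> \<longrightarrow>
               int (nb n \<beta>) = (int n - 2) * \<bar>braid_inf n \<beta>\<bar>) \<and>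
            (braid_inf n \<beta> < braid_sup n \<beta> \<and> braid_sup n \<beta> \<le> 0 \<longrightarrow>
               - writhe n \<beta> = (int n - 2) * \<bar>braid_inf n \<beta>\<bar> + \<bar>braid_sup n \<beta>\<bar>))"
proof -
  interpret braid_monoid "braid_group n" n
    by (intro braid_monoid.intro braid_monoid_axioms.intro group_braid_group refl)
  have n: "2 \<le> n" using assms(1) by simp
  have "- writhe n \<beta> \<le> (int n - 2) * \<bar>braid_inf n \<beta>\<bar> + \<bar>braid_sup n \<beta>\<bar>"
    if "braid_inf n \<beta> < braid_sup n \<beta>" "braid_sup n \<beta> \<le> 0"
    using neg_writhe_le[OF assms(2) n] that by simp
  then show ?thesis
    using nb_le_of_inf_neg[OF assms(2) n] nb_eq_of_sup_nonpos[OF assms(2) n]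
      nb_eq_3[OF _ assms(2)] neg_writhe_eq_3[OF _ assms(2)]
    by blast
qed

end
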